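(* Let $K$ be a field of characteristic different from $2$ and let $n\ge 2$. (1) For any group $G$, the support of an elementary $G$-grading on $\mathrm{UJ}_n$ is commutative (any two of its elements commute). (2) Let $G$ be an abelian group. Define an equivalence relation on $G^{n-1}$ by: for $\mu_1,\mu_2\in G^{n-1}$ with $\mu_2=(a_1,a_2,\dots,a_{n-1})$, $\mu_1\sim\mu_2$ if and only if $\mu_1=\mu_2$ or $\mu_1=(a_{n-1},\dots,a_2,a_1)$. Then there is a one-to-one correspondence between $G^{n-1}/\!\sim$ and the set of isomorphism classes (as $G$-graded algebras) of elementary $G$-gradings on $\mathrm{UJ}_n$, the class of $\eta\in G^{n-1}$ corresponding to the isomorphism class of $(\mathrm{UJ}_n,\eta)$.
   Context: $\mathrm{UJ}_n$ is the $K$-vector space of upper triangular $n\times n$ matrices over $K$ with the Jordan product $a\circ b=ab+ba$. A $G$-grading on an algebra $A$ is a vector space decomposition $A=\bigoplus_{g\in G}A_g$ with $A_g\circ A_h\subseteq A_{gh}$ for all $g,h\in G$; the nonzero elements of $A_g$ are homogeneous of degree $g$ (written $\deg$), and the support is $\{g\in G: A_g\neq 0\}$. An isomorphism of $G$-graded algebras is an algebra isomorphism mapping the component of degree $g$ onto the component of degree $g$ for every $g\in G$. A $G$-grading on $\mathrm{UJ}_n$ is elementary if all matrix units $e_{ij}$ ($i\le j$) are homogeneous. For $G$ abelian and $\eta=(g_1,\dots,g_{n-1})\in G^{n-1}$, $(\mathrm{UJ}_n,\eta)$ denotes $\mathrm{UJ}_n$ with the elementary $G$-grading determined by $\deg e_{i,i+1}=g_i$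 for $i=1,\dots,n-1$ (so $\deg e_{ii}=1$ and $\deg e_{ij}=g_ig_{i+1}\cdots g_{j-1}$ for $i<j$). *)

theory Defs
  imports "Jordan_Normal_Form.VS_Connect" "HOL-Library.FuncSet"
begin

text \<open>A (not necessarily associative) algebra over the field \<open>K\<close> is given by a record of type
  \<^typ>\<open>('k, 'a) module\<close>: its field \<open>mult\<close> is the algebra product, and no associativity is assumed of it.
  A \<open>G\<close>-grading is the family \<open>D\<close> of its components, indexed by \<^term>\<open>carrier G\<close>.\<close>

definition is_grading ::
  "('g, 'm) monoid_scheme \<Rightarrow> ('k, 'r) ring_scheme \<Rightarrow> ('k, 'a, 's) module_scheme \<Rightarrow> ('g \<Rightarrow> 'a set) \<Rightarrow> bool"
where
  "is_grading G K A D \<longleftrightarrow>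
     D \<in> extensional (carrier G) \<and>
     (\<forall>g\<in>carrier G. VectorSpace.subspace K (D g) A) \<and>
     (\<forall>a\<in>carrier A. \<exists>!f. f \<in> Pi\<^sub>E (carrier G) D \<and>
        finite {g \<in> carrier G. f g \<noteq> \<zero>\<^bsub>A\<^esub>} \<and>
        a = finsum A f {g \<in> carrier G. f g \<noteq> \<zero>\<^bsub>A\<^esub>}) \<and>
     (\<forall>g\<in>carrier G. \<forall>h\<in>carrier G. \<forall>x\<in>D g. \<forall>y\<in>D h. x \<otimes>\<^bsub>A\<^esub> y \<in> D (g \<otimes>\<^bsub>G\<^esub> h))"

definition grading_support ::
  "('g, 'm) monoid_scheme \<Rightarrow> ('k, 'a, 's) module_scheme \<Rightarrow> ('g \<Rightarrow> 'a set) \<Rightarrow> 'g set"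
where
  "grading_support G A D = {g \<in> carrier G. D g \<noteq> {\<zero>\<^bsub>A\<^esub>}}"

definition homogeneous ::
  "('g, 'm) monoid_scheme \<Rightarrow> ('k, 'a, 's) module_scheme \<Rightarrow> ('g \<Rightarrow> 'a set) \<Rightarrow> 'a \<Rightarrow> bool"
where
  "homogeneous G A D x \<longleftrightarrow> (\<exists>g\<in>carrier G. x \<in> D g \<and> x \<noteq> \<zero>\<^bsub>A\<^esub>)"

definition graded_isomorphic ::
  "('g, 'm) monoid_scheme \<Rightarrow> ('k, 'r) ring_scheme \<Rightarrow>
     ('k, 'a, 's) module_scheme \<Rightarrow> ('g \<Rightarrow> 'a set) \<Rightarrow> ('k, 'b, 't) module_scheme \<Rightarrow> ('g \<Rightarrow> 'b set) \<Rightarrow> bool"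
where
  "graded_isomorphic G K A D B E \<longleftrightarrow>
     (\<exists>\<phi> \<in> LinearCombinations.module_hom K A B.
        bij_betw \<phi> (carrier A) (carrier B) \<and>
        (\<forall>x\<in>carrier A. \<forall>y\<in>carrier A. \<phi> (x \<otimes>\<^bsub>A\<^esub> y) = \<phi> x \<otimes>\<^bsub>B\<^esub> \<phi> y) \<and>
        (\<forall>g\<in>carrier G. \<phi> ` D g = E g))"

definition jordan_prod :: "'k::field mat \<Rightarrow> 'k mat \<Rightarrow> 'k mat" where
  "jordan_prod a b = a * b + b * a"

text \<open>The field \<open>one\<close> is the unit of the Jordan product when \<open>2\<close> is invertible; it plays no role
  in gradings and isomorphisms.\<close>

definition UJ :: "nat \<Rightarrow> ('k::field, 'k mat) module" where
  "UJ n = \<lparr>carrier = {a \<in> carrier_mat n n. upper_triangular a},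
           mult = jordan_prod,
           one = inverse 2 \<cdot>\<^sub>m 1\<^sub>m n,
           zero = 0\<^sub>m n n,
           add = (+),
           smult = (\<cdot>\<^sub>m)\<rparr>"

text \<open>Rows and columns are indexed from \<open>0\<close>, as in \<^typ>\<open>'k mat\<close>.\<close>

definition matrix_unit :: "nat \<Rightarrow> nat \<Rightarrow> nat \<Rightarrow> 'k::field mat" where
  "matrix_unit n i j = mat n n (\<lambda>(p, q). if p = i \<and> q = j then 1 else 0)"

definition elementary_gradings ::
  "('g, 'm) monoid_scheme \<Rightarrow> nat \<Rightarrow> ('g \<Rightarrow> 'k::field mat set) set"
where
  "elementary_gradings G n =
     {D. is_grading G class_ring (UJ n) D \<and>
         (\<forall>i j. i \<le> j \<and> j < n \<longrightarrow> homogeneous G (UJ n) D (matrix_unit n i j))}"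

definition elementary_iso_rel ::
  "('g, 'm) monoid_scheme \<Rightarrow> nat \<Rightarrow> (('g \<Rightarrow> 'k::field mat set) \<times> ('g \<Rightarrow> 'k mat set)) set"
where
  "elementary_iso_rel G n =
     {(D, E). D \<in> elementary_gradings G n \<and> E \<in> elementary_gradings G n \<and>
              graded_isomorphic G class_ring (UJ n) D (UJ n) E}"

text \<open>Elements of \<open>G\<^sup>m\<close> are lists of length \<open>m\<close>.\<close>

definition group_tuples :: "('g, 'm) monoid_scheme \<Rightarrow> nat \<Rightarrow> 'g list set" where
  "group_tuples G m = {\<eta>. length \<eta> = m \<and> set \<eta> \<subseteq> carrier G}"

definition reversal_rel :: "('g, 'm) monoid_scheme \<Rightarrow> nat \<Rightarrow> ('g list \<times> 'g list) set" where
  "reversal_rel G m =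
     {(\<mu>, \<nu>). \<mu> \<in> group_tuples G m \<and> \<nu> \<in> group_tuples G m \<and> (\<mu> = \<nu> \<or> \<mu> = rev \<nu>)}"

text \<open>With indices from \<open>0\<close>, \<open>\<eta> ! i\<close> is the degree of the matrix unit at \<open>(i, i + 1)\<close>, and the
  one at \<open>(i, j)\<close>, \<open>i \<le> j\<close>, gets the product of \<open>\<eta> ! k\<close> over \<open>i \<le> k < j\<close>. The component of degree
  \<open>g\<close> is the span of the matrix units of degree \<open>g\<close>, i.e. it consists of the upper triangular
  matrices whose nonzero entries are all at positions of degree \<open>g\<close>.\<close>

definition unit_degree :: "('g, 'm) monoid_scheme \<Rightarrow> 'g list \<Rightarrow> nat \<Rightarrow> nat \<Rightarrow> 'g" where
  "unit_degree G \<eta> i j = finprod G (\<lambda>k. \<eta> ! k) {i..<j}"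

definition grading_of_tuple ::
  "('g, 'm) monoid_scheme \<Rightarrow> nat \<Rightarrow> 'g list \<Rightarrow> 'g \<Rightarrow> 'k::field mat set"
where
  "grading_of_tuple G n \<eta> =
     (\<lambda>g\<in>carrier G. {a \<in> carrier (UJ n).
        \<forall>i j. i \<le> j \<and> j < n \<and> a $$ (i, j) \<noteq> 0 \<longrightarrow> unit_degree G \<eta> i j = g})"

lemma equiv_reversal_rel: "equiv (group_tuples G m) (reversal_rel G m)"
  by (rule equivI)
    (auto simp: reversal_rel_def refl_on_def sym_def trans_def)

lemma is_gradingD_subset:
  assumes "is_grading G K A D" "g \<in> carrier G"
  shows "D g \<subseteq> carrier A"
  using assms
  by (auto simp: is_grading_def VectorSpace.subspace_def LinearCombinations.submodule_def)

lemma UJ_add_closed: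
  assumes "x \<in> carrier (UJ n)" "y \<in> carrier (UJ n)"
  shows "x \<oplus>\<^bsub>UJ n\<^esub> y \<in> carrier (UJ n)"
  using assms by (auto simp: UJ_def upper_triangular_def)

lemma UJ_smult_closed:
  assumes "x \<in> carrier (UJ n)"
  shows "c \<odot>\<^bsub>UJ n\<^esub> x \<in> carrier (UJ n)"
  using assms by (auto simp: UJ_def upper_triangular_def)

lemma UJ_mult_closed:
  assumes "x \<in> carrier (UJ n)" "y \<in> carrier (UJ n)"
  shows "x \<otimes>\<^bsub>UJ n\<^esub> y \<in> carrier (UJ n)"
proof -
  have "upper_triangular (a * b)"
    if "a \<in> carrier_mat n n" "b \<in> carrier_mat n n" "upper_triangular a" "upper_triangular b"
    for a b :: "'a mat"
  proof (unfold upper_triangular_def, intro allI impI)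
    fix i j assume "i < dim_row (a * b)" "j < i"
    then have ij: "i < n" "j < i" using that by auto
    have "(a * b) $$ (i, j) = (\<Sum>k<n. a $$ (i, k) * b $$ (k, j))"
      using that ij by (auto simp: scalar_prod_def lessThan_atLeast0 intro!: sum.cong)
    also have "\<dots> = 0"
    proof (intro sum.neutral ballI)
      fix k assume "k \<in> {..<n}"
      then show "a $$ (i, k) * b $$ (k, j) = 0"
        using that ij by (cases "k < i") (auto simp: upper_triangular_def)
    qed
    finally show "(a * b) $$ (i, j) = 0" .
  qed
  then show ?thesis
    using assms by (auto simp: UJ_def jordan_prod_def upper_triangular_def)
qed

lemma equiv_elementary_iso_rel:
  "equiv (elementary_gradings G n :: ('g \<Rightarrow> 'k::field mat set) set) (elementary_iso_rel G n)"
  (is "equiv ?E ?R")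
proof (rule equivI)
  show "?R \<subseteq> ?E \<times> ?E"
    by (auto simp: elementary_iso_rel_def)
  have "graded_isomorphic G class_ring (UJ n) D (UJ n) D" for D :: "'g \<Rightarrow> 'k mat set"
    unfolding graded_isomorphic_def
    by (rule bexI[of _ id]) (auto simp: LinearCombinations.module_hom_def)
  then show "refl_on ?E ?R"
    by (auto simp: elementary_iso_rel_def refl_on_def)
  show "sym ?R"
  proof (rule symI)
    fix D E :: "'g \<Rightarrow> 'k mat set"
    assume DE: "(D, E) \<in> ?R"
    let ?U = "UJ n :: ('k, 'k mat) module"
    obtain \<phi> where \<phi>: "\<phi> \<in> LinearCombinations.module_hom class_ring ?U ?U" "bij_betw \<phi> (carrier ?U) (carrier ?U)"
      "\<forall>x\<in>carrier ?U. \<forall>y\<in>carrier ?U. \<phi> (x \<otimes>\<^bsub>?U\<^esub> y) = \<phi> x \<otimes>\<^bsub>?U\<^esub> \<phi> y"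
      "\<forall>g\<in>carrier G. \<phi> ` D g = E g"
      using DE by (auto simp: elementary_iso_rel_def graded_isomorphic_def)
    define \<psi> where "\<psi> = inv_into (carrier ?U) \<phi>"
    have inj: "inj_on \<phi> (carrier ?U)" and im: "\<phi> ` carrier ?U = carrier ?U"
      using \<phi>(2) by (auto simp: bij_betw_def)
    have \<psi>U: "\<psi> y \<in> carrier ?U" "\<phi> (\<psi> y) = y" if "y \<in> carrier ?U" for y
      using that im by (auto simp: \<psi>_def inv_into_into f_inv_into_f)
    have \<psi>\<phi>: "\<psi> z = x" if "x \<in> carrier ?U" "\<phi> x = z" for x z
      using that inj by (auto simp: \<psi>_def)
    have "\<psi> \<in> LinearCombinations.module_hom class_ring ?U ?U"
      unfolding LinearCombinations.module_hom_def
    proof (intro CollectI conjI allI impI)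
      show "\<psi> \<in> carrier ?U \<rightarrow> carrier ?U" using \<psi>U by auto
      fix x y assume "x \<in> carrier ?U \<and> y \<in> carrier ?U"
      then show "\<psi> (x \<oplus>\<^bsub>?U\<^esub> y) = \<psi> x \<oplus>\<^bsub>?U\<^esub> \<psi> y"
        using \<phi>(1) \<psi>U by (intro \<psi>\<phi> UJ_add_closed) (auto simp: LinearCombinations.module_hom_def)
    next
      fix r x assume "r \<in> carrier (class_ring :: 'k ring) \<and> x \<in> carrier ?U"
      then show "\<psi> (r \<odot>\<^bsub>?U\<^esub> x) = r \<odot>\<^bsub>?U\<^esub> \<psi> x"
        using \<phi>(1) \<psi>U by (intro \<psi>\<phi> UJ_smult_closed) (auto simp: LinearCombinations.module_hom_def)
    qed
    moreover have "bij_betw \<psi> (carrier ?U) (carrier ?U)"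
      unfolding \<psi>_def by (rule bij_betw_inv_into[OF \<phi>(2)])
    moreover have "\<psi> (x \<otimes>\<^bsub>?U\<^esub> y) = \<psi> x \<otimes>\<^bsub>?U\<^esub> \<psi> y"
      if "x \<in> carrier ?U" "y \<in> carrier ?U" for x y
      using that \<phi>(3) \<psi>U by (intro \<psi>\<phi> UJ_mult_closed) auto
    moreover have "\<psi> ` E g = D g" if g: "g \<in> carrier G" for g
    proof -
      have "D g \<subseteq> carrier ?U"
        using DE g by (intro is_gradingD_subset[of G class_ring])
          (auto simp: elementary_iso_rel_def elementary_gradings_def)
      then have "\<psi> ` \<phi> ` D g = D g"
        unfolding \<psi>_def by (rule inv_into_image_cancel[OF inj])
      then show ?thesis using \<phi>(4) g by auto
    qed
    ultimately have "graded_isomorphic G class_ring ?U E ?U D"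
      unfolding graded_isomorphic_def by blast
    then show "(E, D) \<in> ?R"
      using DE by (auto simp: elementary_iso_rel_def)
  qed
  show "trans ?R"
  proof (rule transI)
    fix D E F :: "'g \<Rightarrow> 'k mat set"
    assume DE: "(D, E) \<in> ?R" and EF: "(E, F) \<in> ?R"
    let ?U = "UJ n :: ('k, 'k mat) module"
    obtain \<phi> where \<phi>: "\<phi> \<in> LinearCombinations.module_hom class_ring ?U ?U" "bij_betw \<phi> (carrier ?U) (carrier ?U)"
      "\<forall>x\<in>carrier ?U. \<forall>y\<in>carrier ?U. \<phi> (x \<otimes>\<^bsub>?U\<^esub> y) = \<phi> x \<otimes>\<^bsub>?U\<^esub> \<phi> y"
      "\<forall>g\<in>carrier G. \<phi> ` D g = E g"
      using DE by (auto simp: elementary_iso_rel_def graded_isomorphic_def)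
    obtain \<psi> where \<psi>: "\<psi> \<in> LinearCombinations.module_hom class_ring ?U ?U" "bij_betw \<psi> (carrier ?U) (carrier ?U)"
      "\<forall>x\<in>carrier ?U. \<forall>y\<in>carrier ?U. \<psi> (x \<otimes>\<^bsub>?U\<^esub> y) = \<psi> x \<otimes>\<^bsub>?U\<^esub> \<psi> y"
      "\<forall>g\<in>carrier G. \<psi> ` E g = F g"
      using EF by (auto simp: elementary_iso_rel_def graded_isomorphic_def)
    have c: "\<phi> x \<in> carrier ?U" if "x \<in> carrier ?U" for x
      using that \<phi>(1) by (auto simp: LinearCombinations.module_hom_def)
    have "\<psi> \<circ> \<phi> \<in> LinearCombinations.module_hom class_ring ?U ?U"
      using \<phi>(1) \<psi>(1) by (auto simp: LinearCombinations.module_hom_def Pi_iff)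
    moreover have "bij_betw (\<psi> \<circ> \<phi>) (carrier ?U) (carrier ?U)"
      by (rule bij_betw_trans[OF \<phi>(2) \<psi>(2)])
    moreover have "(\<psi> \<circ> \<phi>) (x \<otimes>\<^bsub>?U\<^esub> y) = (\<psi> \<circ> \<phi>) x \<otimes>\<^bsub>?U\<^esub> (\<psi> \<circ> \<phi>) y"
      if "x \<in> carrier ?U" "y \<in> carrier ?U" for x y
      using that \<phi>(3) \<psi>(3) c by simp
    moreover have "(\<psi> \<circ> \<phi>) ` D g = F g" if "g \<in> carrier G" for g
      using that \<phi>(4) \<psi>(4) by (metis image_comp)
    ultimately have "graded_isomorphic G class_ring ?U D ?U F"
      unfolding graded_isomorphic_def by blast
    then show "(D, F) \<in> ?R"
      using DE EF by (auto simp: elementary_iso_rel_def)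
  qed
qed

end

theory Submission
  imports Defs
begin

text \<open>
  The products of \<open>e\<^sub>i\<^sub>j\<close> and \<open>e\<^sub>j\<^sub>k\<close> in both orders have a nonzero entry at \<open>(i, k)\<close>, so the degree of
  \<open>e\<^sub>i\<^sub>k\<close> is the product of the degrees of \<open>e\<^sub>i\<^sub>j\<close> and \<open>e\<^sub>j\<^sub>k\<close> in either order. Commutation then spreads
  from consecutive intervals to all intervals, and for abelian \<open>G\<close> an elementary grading is determined
  by its degrees on the superdiagonal. Reflection in the antidiagonal realises the reversal of a tuple.

  Conversely, an automorphism \<open>\<phi>\<close> sends the \<open>e\<^sub>i\<^sub>i\<close> to orthogonal idempotents whose diagonals are again
  diagonals of matrix units, which gives a permutation \<open>\<sigma>\<close> of the indices. Modulo the square of the strictly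
  triangular part, some \<open>\<phi> e\<^sub>i\<^sub>,\<^sub>i\<^sub>+\<^sub>1\<close> has a nonzero entry at \<open>(k, k + 1)\<close>, and its Peirce components
  force \<open>{\<sigma> i, \<sigma> (i + 1)} = {k, k + 1}\<close>. Thus \<open>\<sigma>\<close> is an automorphism of a path, i.e. the identity or
  the reversal, and comparing degrees at these entries recovers the tuple up to reversal.
\<close>

subsection \<open>The space of upper triangular matrices\<close>

lemma UJ_simps [simp]:
  "x \<oplus>\<^bsub>UJ n\<^esub> y = x + y" "x \<otimes>\<^bsub>UJ n\<^esub> y = jordan_prod x y" "c \<odot>\<^bsub>UJ n\<^esub> x = c \<cdot>\<^sub>m x"
  "\<zero>\<^bsub>UJ n\<^esub> = 0\<^sub>m n n"
  by (simp_all add: UJ_def)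

lemma carrier_UJ_iff:
  "x \<in> carrier (UJ n) \<longleftrightarrow> x \<in> carrier_mat n n \<and> (\<forall>i<n. \<forall>j<i. x $$ (i, j) = 0)"
  by (auto simp: UJ_def upper_triangular_def)

lemma UJ_carrier_mat: "x \<in> carrier (UJ n) \<Longrightarrow> x \<in> carrier_mat n n"
  by (simp add: carrier_UJ_iff)

lemma UJ_eqI:
  assumes "x \<in> carrier (UJ n)" "y \<in> carrier (UJ n)"
    and "\<And>i j. i \<le> j \<Longrightarrow> j < n \<Longrightarrow> x $$ (i, j) = y $$ (i, j)"
  shows "x = y"
proof (rule eq_matI)
  fix i j assume ij: "i < dim_row y" "j < dim_col y"
  show "x $$ (i, j) = y $$ (i, j)"
    using assms ij by (cases "i \<le> j") (auto simp: carrier_UJ_iff)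
qed (use assms in \<open>auto simp: carrier_UJ_iff\<close>)

lemma jordan_prod_index:
  assumes "x \<in> carrier_mat n n" "y \<in> carrier_mat n n" "i < n" "j < n"
  shows "jordan_prod x y $$ (i, j) = (\<Sum>k<n. x $$ (i, k) * y $$ (k, j) + y $$ (i, k) * x $$ (k, j))"
  using assms by (simp add: jordan_prod_def scalar_prod_def lessThan_atLeast0 sum.distrib)

text \<open>For \<open>k\<close> outside \<open>{i..j}\<close> one factor of each product lies below
  the diagonal.\<close>

lemma jordan_prod_index_UJ:
  assumes "x \<in> carrier (UJ n)" "y \<in> carrier (UJ n)" "i < n" "j < n"
  shows "jordan_prod x y $$ (i, j) = (\<Sum>k=i..j. x $$ (i, k) * y $$ (k, j) + y $$ (i, k) * x $$ (k, j))"
proof -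
  have "(\<Sum>k<n. x $$ (i, k) * y $$ (k, j) + y $$ (i, k) * x $$ (k, j))
      = (\<Sum>k=i..j. x $$ (i, k) * y $$ (k, j) + y $$ (i, k) * x $$ (k, j))"
  proof (rule sum.mono_neutral_right)
    show "\<forall>k\<in>{..<n} - {i..j}. x $$ (i, k) * y $$ (k, j) + y $$ (i, k) * x $$ (k, j) = 0"
    proof
      fix k assume "k \<in> {..<n} - {i..j}"
      then have "k < n" "k < i \<or> j < k" by auto
      then show "x $$ (i, k) * y $$ (k, j) + y $$ (i, k) * x $$ (k, j) = 0"
        using assms by (auto simp: carrier_UJ_iff)
    qed
  qed (use assms in auto)
  then show ?thesis
    using jordan_prod_index[OF UJ_carrier_mat[OF assms(1)] UJ_carrier_mat[OF assms(2)] assms(3,4)] by simp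
qed

lemma jordan_prod_diag:
  assumes "x \<in> carrier (UJ n)" "y \<in> carrier (UJ n)" "k < n"
  shows "jordan_prod x y $$ (k, k) = 2 * (x $$ (k, k) * y $$ (k, k))"
  using assms by (simp add: jordan_prod_index_UJ)

text \<open>Only two indices lie between \<open>k\<close> and \<open>Suc k\<close>, so this entry is
  determined by the diagonals and superdiagonals of the factors. It serves computations modulo the
  square of the strictly triangular part.\<close>

lemma jordan_prod_superdiag:
  assumes "x \<in> carrier (UJ n)" "y \<in> carrier (UJ n)" "Suc k < n"
  shows "jordan_prod x y $$ (k, Suc k) =
    (x $$ (k, k) + x $$ (Suc k, Suc k)) * y $$ (k, Suc k) +
    (y $$ (k, k) + y $$ (Suc k, Suc k)) * x $$ (k, Suc k)"
  using assms by (simp add: jordan_prod_index_UJ algebra_simps)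

lemma matrix_unit_index [simp]:
  "p < n \<Longrightarrow> q < n \<Longrightarrow> matrix_unit n i j $$ (p, q) = (if p = i \<and> q = j then 1 else 0)"
  by (simp add: matrix_unit_def)

lemma matrix_unit_dim [simp]: "dim_row (matrix_unit n i j) = n" "dim_col (matrix_unit n i j) = n"
  by (simp_all add: matrix_unit_def)

lemma matrix_unit_carrier_mat: "matrix_unit n i j \<in> carrier_mat n n"
  by (simp add: matrix_unit_def)

lemma matrix_unit_UJ: "i \<le> j \<Longrightarrow> matrix_unit n i j \<in> carrier (UJ n)"
  by (auto simp: carrier_UJ_iff matrix_unit_def)

lemma matrix_unit_nonzero:
  assumes "i < n" "j < n"
  shows "matrix_unit n i j \<noteq> 0\<^sub>m n n"
proof
  assume "matrix_unit n i j = (0\<^sub>m n n :: 'a mat)"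
  then have "matrix_unit n i j $$ (i, j) = (0\<^sub>m n n :: 'a mat) $$ (i, j)" by simp
  then show False using assms by simp
qed

lemma matrix_unit_mult:
  assumes "j < n" "k < n"
  shows "matrix_unit n i j * matrix_unit n k l = (if j = k then matrix_unit n i l else (0\<^sub>m n n :: 'k::field mat))"
    (is "?l = ?r")
proof (rule eq_matI)
  fix p q assume "p < dim_row ?r" "q < dim_col ?r"
  then have pq: "p < n" "q < n" by (simp_all split: if_splits)
  have "?l $$ (p, q) = (\<Sum>m<n. matrix_unit n i j $$ (p, m) * matrix_unit n k l $$ (m, q))"
    using pq by (simp add: scalar_prod_def lessThan_atLeast0)
  also have "\<dots> = (\<Sum>m<n. if m = j then if p = i \<and> j = k \<and> q = l then 1 else 0 else 0)"
    using pq by (intro sum.cong refl) simp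
  also have "\<dots> = ?r $$ (p, q)"
    using pq assms by simp
  finally show "?l $$ (p, q) = ?r $$ (p, q)" .
qed simp_all

lemma jordan_prod_matrix_unit:
  assumes "j < n" "k < n" "i < n" "l < n"
  shows "jordan_prod (matrix_unit n i j) (matrix_unit n k l) =
    (if j = k then matrix_unit n i l else 0\<^sub>m n n) + (if l = i then matrix_unit n k j else 0\<^sub>m n n)"
  using assms by (simp add: jordan_prod_def matrix_unit_mult)

text \<open>The entry is 1, except when \<open>i = j = k\<close>: then both orders contribute and it
  is 2, so the characteristic matters for the idempotents.\<close>

lemma jordan_prod_matrix_unit_chain_nonzero:
  assumes "(2::'k::field) \<noteq> 0" "i \<le> j" "j \<le> k" "k < n"
  shows "jordan_prod (matrix_unit n i j) (matrix_unit n j k) $$ (i, k) \<noteq> (0::'k)"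
    and "jordan_prod (matrix_unit n j k) (matrix_unit n i j) $$ (i, k) \<noteq> (0::'k)"
  using assms by (auto simp: jordan_prod_matrix_unit)

lemma UJ_vectorspace: "vectorspace (class_ring :: 'k::field ring) (UJ n)"
proof -
  have ag: "abelian_group (UJ n :: ('k, 'k mat) module)"
  proof (rule abelian_groupI)
    fix x :: "'k mat" assume x: "x \<in> carrier (UJ n)"
    then show "\<exists>y\<in>carrier (UJ n). y \<oplus>\<^bsub>UJ n\<^esub> x = \<zero>\<^bsub>UJ n\<^esub>"
      by (intro bexI[of _ "- x"]) (auto simp: carrier_UJ_iff)
  qed (auto simp: carrier_UJ_iff intro: comm_add_mat)
  have "module (class_ring :: 'k ring) (UJ n)"
  proof (unfold Module.module_def module_axioms_def, intro conjI)
    show "cring (class_ring :: 'k ring)"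
      using class_field[where 'a='k] by (simp add: field_def domain_def)
  qed (use ag in \<open>auto simp: carrier_UJ_iff class_ring_simps
        intro: add_smult_distrib_right_mat add_smult_distrib_left_mat\<close>)
  then show ?thesis
    using class_field by (simp add: vectorspace_def)
qed

lemma UJ_abelian_monoid: "abelian_monoid (UJ n :: ('k::field, 'k mat) module)"
proof -
  interpret vectorspace "class_ring :: 'k ring" "UJ n" by (rule UJ_vectorspace)
  show ?thesis by unfold_locales
qed

text \<open>Reduces the abstract sums in the definition of a grading to field sums, one entry at a
  time.\<close>

lemma finsum_UJ:
  assumes "finite S" "f \<in> S \<rightarrow> carrier (UJ n :: ('k::field, 'k mat) module)"
  shows "finsum (UJ n) f S \<in> carrier (UJ n)"
    and "\<And>i j. i < n \<Longrightarrow> j < n \<Longrightarrow> finsum (UJ n) f S $$ (i, j) = (\<Sum>s\<in>S. f s $$ (i, j))"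
proof -
  interpret abelian_monoid "UJ n :: ('k, 'k mat) module" by (rule UJ_abelian_monoid)
  show "finsum (UJ n) f S \<in> carrier (UJ n)"
    using assms by (intro finsum_closed) auto
  fix i j assume ij: "i < n" "j < n"
  show "finsum (UJ n) f S $$ (i, j) = (\<Sum>s\<in>S. f s $$ (i, j))"
    using assms
  proof (induction S rule: finite_induct)
    case (insert s S)
    have "finsum (UJ n) f S \<in> carrier (UJ n)"
      using insert by (intro finsum_closed) auto
    then show ?case
      using insert ij finsum_insert[OF insert(1,2), of f] by (auto simp: carrier_UJ_iff)
  qed (use ij in simp)
qed

text \<open>A form of spanning by matrix units that serves both for subspaces and for checking linear identities.\<close>

lemma UJ_span:
  assumes x: "x \<in> carrier (UJ n)" and zero: "0\<^sub>m n n \<in> V"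
    and add: "\<And>u v. u \<in> V \<Longrightarrow> v \<in> V \<Longrightarrow> u + v \<in> V"
    and unit: "\<And>i j. i \<le> j \<Longrightarrow> j < n \<Longrightarrow> x $$ (i, j) \<cdot>\<^sub>m matrix_unit n i j \<in> V"
  shows "x \<in> V"
proof -
  let ?T = "{(i, j). i \<le> j \<and> j < n}"
  let ?r = "\<lambda>S. mat n n (\<lambda>ij. if ij \<in> S then x $$ ij else 0)"
  have "?T \<subseteq> {..<n} \<times> {..<n}" by auto
  then have fin: "finite ?T" by (rule finite_subset) auto
  \<comment> \<open>\<open>?r S\<close> is \<open>x\<close> with the entries outside
    \<open>S\<close> erased; adding one position at a time rebuilds \<open>x\<close> from scaled
    matrix units without leaving \<open>V\<close>.\<close>
  have "S \<subseteq> ?T \<Longrightarrow> ?r S \<in> V" if "finite S" for S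
    using that
  proof (induction S rule: finite_induct)
    case empty
    have "?r {} = 0\<^sub>m n n" by (rule eq_matI) auto
    then show ?case using zero by simp
  next
    case (insert s S)
    obtain i j where s: "s = (i, j)" "i \<le> j" "j < n" using insert by (cases s) auto
    have "?r (insert s S) = ?r S + x $$ (i, j) \<cdot>\<^sub>m matrix_unit n i j"
      using insert s by (intro eq_matI) (auto simp: matrix_unit_def)
    then show ?case using insert s add unit by auto
  qed
  then have "?r ?T \<in> V" using fin by blast
  moreover have "?r ?T = x"
    using x by (intro UJ_eqI[of _ n]) (auto simp: carrier_UJ_iff)
  ultimately show ?thesis by simp
qed

subsection \<open>Gradings given by the degrees of the matrix units\<close>

text \<open>Degrees are an arbitrary function of the position. This covers noncommutative groups,
  for which the unordered product in \<open>unit_degree\<close> is unsuitable, and lets an unknown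
  elementary grading and \<open>grading_of_tuple\<close> be treated alike.\<close>

definition position_grading ::
  "('g, 'm) monoid_scheme \<Rightarrow> nat \<Rightarrow> (nat \<Rightarrow> nat \<Rightarrow> 'g) \<Rightarrow> 'g \<Rightarrow> 'k::field mat set"
where
  "position_grading G n d =
     (\<lambda>g\<in>carrier G. {a \<in> carrier (UJ n). \<forall>i j. i \<le> j \<and> j < n \<and> a $$ (i, j) \<noteq> 0 \<longrightarrow> d i j = g})"

lemma grading_of_tuple_eq: "grading_of_tuple G n \<eta> = position_grading G n (unit_degree G \<eta>)"
  by (simp add: grading_of_tuple_def position_grading_def)

lemma position_grading_cong:
  assumes "\<And>i j. i \<le> j \<Longrightarrow> j < n \<Longrightarrow> d i j = d' i j"
  shows "position_grading G n d = position_grading G n d'"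
  using assms by (auto simp: position_grading_def intro!: restrict_ext)

lemma position_gradingI:
  assumes "g \<in> carrier G" "a \<in> carrier (UJ n)"
    "\<And>i j. i \<le> j \<Longrightarrow> j < n \<Longrightarrow> a $$ (i, j) \<noteq> 0 \<Longrightarrow> d i j = g"
  shows "a \<in> position_grading G n d g"
  using assms by (auto simp: position_grading_def)

lemma position_gradingD:
  assumes "a \<in> position_grading G n d g" "g \<in> carrier G"
  shows "a \<in> carrier (UJ n)" "\<And>i j. i \<le> j \<Longrightarrow> j < n \<Longrightarrow> a $$ (i, j) \<noteq> 0 \<Longrightarrow> d i j = g"
  using assms by (auto simp: position_grading_def)

text \<open>Candidate for the homogeneous component of degree \<open>g\<close>. Junk values of
  \<open>d\<close> below the diagonal do no harm to triangular \<open>a\<close>, whose entries there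
  vanish.\<close>

definition degree_part :: "nat \<Rightarrow> (nat \<Rightarrow> nat \<Rightarrow> 'g) \<Rightarrow> 'k::field mat \<Rightarrow> 'g \<Rightarrow> 'k mat" where
  "degree_part n d a g = mat n n (\<lambda>(i, j). if d i j = g then a $$ (i, j) else 0)"

lemma degree_part_index [simp]:
  "i < n \<Longrightarrow> j < n \<Longrightarrow> degree_part n d a g $$ (i, j) = (if d i j = g then a $$ (i, j) else 0)"
  by (simp add: degree_part_def)

lemma degree_part_UJ: "a \<in> carrier (UJ n) \<Longrightarrow> degree_part n d a g \<in> carrier (UJ n)"
  by (auto simp: carrier_UJ_iff degree_part_def)

lemma degree_part_mem:
  "a \<in> carrier (UJ n) \<Longrightarrow> g \<in> carrier G \<Longrightarrow> degree_part n d a g \<in> position_grading G n d g"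
  by (rule position_gradingI) (auto simp: degree_part_UJ split: if_splits)

lemma degree_part_decomposition:
  fixes G :: "('g, 'm) monoid_scheme" and d :: "nat \<Rightarrow> nat \<Rightarrow> 'g"
    and a :: "'k::field mat"
  assumes a: "a \<in> carrier (UJ n)" and d: "\<And>i j. i \<le> j \<Longrightarrow> j < n \<Longrightarrow> d i j \<in> carrier G"
  defines "S \<equiv> {g \<in> carrier G. degree_part n d a g \<noteq> \<zero>\<^bsub>UJ n\<^esub>}"
  shows "finite S" "finsum (UJ n) (\<lambda>g\<in>carrier G. degree_part n d a g) S = a"
proof -
  have "S \<subseteq> (\<lambda>(i, j). d i j) ` ({..<n} \<times> {..<n})"
  proof
    fix g assume g: "g \<in> S"
    have "\<exists>i<n. \<exists>j<n. d i j = g"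
    proof (rule ccontr)
      assume "\<not> ?thesis"
      then have "degree_part n d a g = 0\<^sub>m n n"
        by (intro eq_matI) (auto simp: degree_part_def)
      then show False using g by (simp add: S_def)
    qed
    then show "g \<in> (\<lambda>(i, j). d i j) ` ({..<n} \<times> {..<n})" by auto
  qed
  then show fin: "finite S" by (rule finite_subset) auto
  let ?f = "\<lambda>g\<in>carrier G. degree_part n d a g"
  have f: "?f \<in> S \<rightarrow> carrier (UJ n)"
    using a by (auto simp: S_def degree_part_UJ)
  show "finsum (UJ n) ?f S = a"
  proof (rule UJ_eqI[OF finsum_UJ(1)[OF fin f] a])
    fix i j assume ij: "i \<le> j" "j < n"
    have "finsum (UJ n) ?f S $$ (i, j) = (\<Sum>g\<in>S. ?f g $$ (i, j))"
      using ij by (intro finsum_UJ(2)[OF fin f]) auto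
    \<comment> \<open>At a fixed position at most one component is nonzero, the one of degree
      \<open>d i j\<close>.\<close>
    also have "\<dots> = (\<Sum>g\<in>S. if g = d i j then a $$ (i, j) else 0)"
      using ij by (intro sum.cong) (auto simp: S_def)
    also have "\<dots> = (if d i j \<in> S then a $$ (i, j) else 0)"
      using fin by simp
    also have "\<dots> = a $$ (i, j)"
    proof (cases "d i j \<in> S")
      \<comment> \<open>If \<open>d i j\<close> is missing from \<open>S\<close>, its component
        vanishes, so the entry of \<open>a\<close> is zero as well.\<close>
      case False
      then have "degree_part n d a (d i j) = 0\<^sub>m n n" using d[OF ij] by (simp add: S_def)
      then have "degree_part n d a (d i j) $$ (i, j) = 0" using ij by simp
      then show ?thesis using ij by simp
    qed simp
    finally show "finsum (UJ n) ?f S $$ (i, j) = a $$ (i, j)" .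
  qed
qed

lemma subspace_position_grading:
  assumes g: "g \<in> carrier G"
  shows "VectorSpace.subspace class_ring (position_grading G n d g) (UJ n :: ('k::field, 'k mat) module)"
  unfolding VectorSpace.subspace_def LinearCombinations.submodule_def
proof (intro conjI UJ_vectorspace allI impI)
  show "module (class_ring :: 'k ring) (UJ n)"
    by (rule vectorspace.axioms(1)[OF UJ_vectorspace])
  fix v w :: "'k mat"
  assume vw: "v \<in> position_grading G n d g" "w \<in> position_grading G n d g"
  note v = position_gradingD[OF vw(1) g] and w = position_gradingD[OF vw(2) g]
  show "v \<oplus>\<^bsub>UJ n\<^esub> w \<in> position_grading G n d g"
  proof (rule position_gradingI[OF g UJ_add_closed[OF v(1) w(1)]])
    fix i j assume "i \<le> j" "j < n" "(v \<oplus>\<^bsub>UJ n\<^esub> w) $$ (i, j) \<noteq> 0"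
    moreover have "w \<in> carrier_mat n n" using w(1) by (simp add: carrier_UJ_iff)
    ultimately have "v $$ (i, j) \<noteq> 0 \<or> w $$ (i, j) \<noteq> 0" by auto
    then show "d i j = g" using v(2) w(2) \<open>i \<le> j\<close> \<open>j < n\<close> by blast
  qed
next
  fix c :: 'k and v :: "'k mat"
  assume cv: "v \<in> position_grading G n d g"
  note v = position_gradingD[OF cv g]
  show "c \<odot>\<^bsub>UJ n\<^esub> v \<in> position_grading G n d g"
    using v(1) by (intro position_gradingI[OF g UJ_smult_closed] v(2)) (auto simp: carrier_UJ_iff)
next
  show "position_grading G n d g \<subseteq> carrier (UJ n :: ('k, 'k mat) module)"
    using position_gradingD(1)[OF _ g] by blast
  show "\<zero>\<^bsub>UJ n\<^esub> \<in> position_grading G n d g"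
    by (rule position_gradingI[OF g]) (auto simp: carrier_UJ_iff)
qed

text \<open>The Jordan product adds the associative products in both orders, so the degree function
  has to be multiplicative along \<open>i \<le> j \<le> k\<close> in both orders.\<close>

lemma position_grading_is_grading:
  fixes G :: "('g, 'm) monoid_scheme" and d :: "nat \<Rightarrow> nat \<Rightarrow> 'g"
  assumes d: "\<And>i j. i \<le> j \<Longrightarrow> j < n \<Longrightarrow> d i j \<in> carrier G"
    and mult: "\<And>i j k. i \<le> j \<Longrightarrow> j \<le> k \<Longrightarrow> k < n \<Longrightarrow> d i k = d i j \<otimes>\<^bsub>G\<^esub> d j k"
    and comm: "\<And>i j k. i \<le> j \<Longrightarrow> j \<le> k \<Longrightarrow> k < n \<Longrightarrow> d i k = d j k \<otimes>\<^bsub>G\<^esub> d i j"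
    and closed: "\<And>g h. g \<in> carrier G \<Longrightarrow> h \<in> carrier G \<Longrightarrow> g \<otimes>\<^bsub>G\<^esub> h \<in> carrier G"
  shows "is_grading G class_ring (UJ n :: ('k::field, 'k mat) module) (position_grading G n d)"
  unfolding is_grading_def
proof (intro conjI ballI subspace_position_grading)
  show "position_grading G n d \<in> extensional (carrier G)"
    by (simp add: position_grading_def)
next
  fix a :: "'k mat" assume a: "a \<in> carrier (UJ n)"
  let ?D = "position_grading G n d :: 'g \<Rightarrow> 'k mat set"
  let ?f = "\<lambda>g\<in>carrier G. degree_part n d a g"
  show "\<exists>!f. f \<in> Pi\<^sub>E (carrier G) ?D \<and> finite {g \<in> carrier G. f g \<noteq> \<zero>\<^bsub>UJ n\<^esub>} \<and>
         a = finsum (UJ n) f {g \<in> carrier G. f g \<noteq> \<zero>\<^bsub>UJ n\<^esub>}"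
  proof (rule ex1I[of _ ?f], intro conjI)
    have "{g \<in> carrier G. ?f g \<noteq> \<zero>\<^bsub>UJ n\<^esub>} = {g \<in> carrier G. degree_part n d a g \<noteq> \<zero>\<^bsub>UJ n\<^esub>}"
      by auto
    then show "finite {g \<in> carrier G. ?f g \<noteq> \<zero>\<^bsub>UJ n\<^esub>}"
      "a = finsum (UJ n) ?f {g \<in> carrier G. ?f g \<noteq> \<zero>\<^bsub>UJ n\<^esub>}"
      using degree_part_decomposition[OF a d] by simp_all
    show "?f \<in> Pi\<^sub>E (carrier G) ?D"
      using a by (auto simp: degree_part_mem)
  next
    fix f :: "'g \<Rightarrow> 'k mat"
    let ?S = "{g \<in> carrier G. f g \<noteq> \<zero>\<^bsub>UJ n\<^esub>}"
    assume "f \<in> Pi\<^sub>E (carrier G) ?D \<and> finite ?S \<and> a = finsum (UJ n) f ?S"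
    then have f: "f \<in> Pi\<^sub>E (carrier G) ?D" and fin: "finite ?S" and eq: "a = finsum (UJ n) f ?S"
      by auto
    have fU: "f g \<in> carrier (UJ n)" "i \<le> j \<Longrightarrow> j < n \<Longrightarrow> f g $$ (i, j) \<noteq> 0 \<Longrightarrow> d i j = g"
      if "g \<in> carrier G" for g i j
      using f that position_gradingD[of "f g" G n d g] by (auto simp: PiE_iff)
    \<comment> \<open>Uniqueness: in any decomposition only the part of degree \<open>d i j\<close>
      can be nonzero at \<open>(i, j)\<close>, so it carries the whole entry.\<close>
    have entry: "a $$ (i, j) = f (d i j) $$ (i, j)" if ij: "i \<le> j" "j < n" for i j
    proof -
      have "a $$ (i, j) = (\<Sum>g\<in>?S. f g $$ (i, j))"
        unfolding eq using ij fU by (intro finsum_UJ(2) fin) auto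
      also have "\<dots> = (\<Sum>g\<in>?S. if g = d i j then f (d i j) $$ (i, j) else 0)"
        using ij fU(2) by (intro sum.cong) auto
      also have "\<dots> = f (d i j) $$ (i, j)"
        using fin d[OF ij] ij by auto
      finally show ?thesis .
    qed
    show "f = ?f"
    proof (rule extensionalityI[of _ "carrier G"])
      fix g assume g: "g \<in> carrier G"
      have "f g = degree_part n d a g"
      proof (rule UJ_eqI[OF fU(1)[OF g] degree_part_UJ[OF a]])
        fix i j assume ij: "i \<le> j" "j < n"
        then show "f g $$ (i, j) = degree_part n d a g $$ (i, j)"
          using fU(2)[OF g ij] entry[OF ij] by auto
      qed
      then show "f g = ?f g" using g by simp
    qed (use f in \<open>auto simp: PiE_iff\<close>)
  qed
next
  fix g h :: 'g and x y :: "'k mat"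
  assume gh: "g \<in> carrier G" "h \<in> carrier G"
    and x: "x \<in> position_grading G n d g" and y: "y \<in> position_grading G n d h"
  note x = position_gradingD[OF x gh(1)] and y = position_gradingD[OF y gh(2)]
  show "x \<otimes>\<^bsub>UJ n\<^esub> y \<in> position_grading G n d (g \<otimes>\<^bsub>G\<^esub> h)"
  proof (rule position_gradingI[OF closed[OF gh] UJ_mult_closed[OF x(1) y(1)]])
    fix i j assume ij: "i \<le> j" "j < n" "(x \<otimes>\<^bsub>UJ n\<^esub> y) $$ (i, j) \<noteq> 0"
    then have "(\<Sum>k=i..j. x $$ (i, k) * y $$ (k, j) + y $$ (i, k) * x $$ (k, j)) \<noteq> 0"
      using jordan_prod_index_UJ[OF x(1) y(1)] by simp
    then obtain k where k: "k \<in> {i..j}" "x $$ (i, k) * y $$ (k, j) + y $$ (i, k) * x $$ (k, j) \<noteq> 0"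
      by (rule sum.not_neutral_contains_not_neutral)
    \<comment> \<open>In the first case the degrees \<open>g\<close> and \<open>h\<close> come in
      this order and \<open>mult\<close> applies; in the second the factors are swapped and
      \<open>comm\<close> applies.\<close>
    then have "x $$ (i, k) \<noteq> 0 \<and> y $$ (k, j) \<noteq> 0 \<or> y $$ (i, k) \<noteq> 0 \<and> x $$ (k, j) \<noteq> 0"
      by auto
    then show "d i j = g \<otimes>\<^bsub>G\<^esub> h"
      using x(2)[of i k] x(2)[of k j] y(2)[of i k] y(2)[of k j] mult[of i k j] comm[of i k j] k(1) ij
      by auto
  qed
qed

lemma position_grading_elementary:
  fixes G :: "('g, 'm) monoid_scheme" and d :: "nat \<Rightarrow> nat \<Rightarrow> 'g"
  assumes d: "\<And>i j. i \<le> j \<Longrightarrow> j < n \<Longrightarrow> d i j \<in> carrier G"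
    and "\<And>i j k. i \<le> j \<Longrightarrow> j \<le> k \<Longrightarrow> k < n \<Longrightarrow> d i k = d i j \<otimes>\<^bsub>G\<^esub> d j k"
    and "\<And>i j k. i \<le> j \<Longrightarrow> j \<le> k \<Longrightarrow> k < n \<Longrightarrow> d i k = d j k \<otimes>\<^bsub>G\<^esub> d i j"
    and "\<And>g h. g \<in> carrier G \<Longrightarrow> h \<in> carrier G \<Longrightarrow> g \<otimes>\<^bsub>G\<^esub> h \<in> carrier G"
  shows "position_grading G n d \<in> (elementary_gradings G n :: ('g \<Rightarrow> 'k::field mat set) set)"
proof -
  have "homogeneous G (UJ n) (position_grading G n d) (matrix_unit n i j :: 'k mat)"
    if "i \<le> j" "j < n" for i j
    unfolding homogeneous_def
  proof (intro bexI[of _ "d i j"] conjI d that)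
    show "matrix_unit n i j \<in> position_grading G n d (d i j)"
      using that by (intro position_gradingI d matrix_unit_UJ) (auto split: if_splits)
    show "(matrix_unit n i j :: 'k mat) \<noteq> \<zero>\<^bsub>UJ n\<^esub>"
      using that by (simp add: matrix_unit_nonzero)
  qed
  then show ?thesis
    using position_grading_is_grading[OF assms] by (auto simp: elementary_gradings_def)
qed

text \<open>Each component contains the span of its matrix units, and uniqueness of homogeneous
  decompositions forbids anything more. Nonzero entries of products of composable matrix units then
  force both product rules on the degrees.\<close>

lemma elementary_grading_is_position_grading:
  fixes G :: "('g, 'm) monoid_scheme" and D :: "'g \<Rightarrow> 'k::field mat set"
  assumes two: "(2::'k) \<noteq> 0" and D: "D \<in> elementary_gradings G n"
    and closed: "\<And>g h. g \<in> carrier G \<Longrightarrow> h \<in> carrier G \<Longrightarrow> g \<otimes>\<^bsub>G\<^esub> h \<in> carrier G"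
  obtains d where "D = position_grading G n d"
    "\<And>i j. i \<le> j \<Longrightarrow> j < n \<Longrightarrow> d i j \<in> carrier G"
    "\<And>i j k. i \<le> j \<Longrightarrow> j \<le> k \<Longrightarrow> k < n \<Longrightarrow> d i k = d i j \<otimes>\<^bsub>G\<^esub> d j k"
    "\<And>i j k. i \<le> j \<Longrightarrow> j \<le> k \<Longrightarrow> k < n \<Longrightarrow> d i k = d j k \<otimes>\<^bsub>G\<^esub> d i j"
proof
  let ?U = "UJ n :: ('k, 'k mat) module"
  have gr: "is_grading G class_ring ?U D"
    and hom: "\<And>i j. i \<le> j \<Longrightarrow> j < n \<Longrightarrow> homogeneous G ?U D (matrix_unit n i j)"
    using D by (auto simp: elementary_gradings_def)
  have extD: "D \<in> extensional (carrier G)"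
    and subD: "\<forall>g\<in>carrier G. VectorSpace.subspace class_ring (D g) ?U"
    and exD: "\<forall>a\<in>carrier ?U. \<exists>!f. f \<in> Pi\<^sub>E (carrier G) D \<and>
        finite {h \<in> carrier G. f h \<noteq> \<zero>\<^bsub>?U\<^esub>} \<and> a = finsum ?U f {h \<in> carrier G. f h \<noteq> \<zero>\<^bsub>?U\<^esub>}"
    and multD: "\<forall>g\<in>carrier G. \<forall>h\<in>carrier G. \<forall>x\<in>D g. \<forall>y\<in>D h. x \<otimes>\<^bsub>?U\<^esub> y \<in> D (g \<otimes>\<^bsub>G\<^esub> h)"
    using gr unfolding is_grading_def by blast+
  define d where "d i j = (SOME g. g \<in> carrier G \<and> matrix_unit n i j \<in> D g)" for i j
  have d: "d i j \<in> carrier G \<and> matrix_unit n i j \<in> D (d i j)" if "i \<le> j" "j < n" for i j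
  proof -
    have "\<exists>g. g \<in> carrier G \<and> matrix_unit n i j \<in> D g"
      using hom[OF that] by (auto simp: homogeneous_def)
    then show ?thesis unfolding d_def by (rule someI_ex)
  qed
  then show dc: "\<And>i j. i \<le> j \<Longrightarrow> j < n \<Longrightarrow> d i j \<in> carrier G" by blast
  have sub: "0\<^sub>m n n \<in> D g" "\<And>u v. u \<in> D g \<Longrightarrow> v \<in> D g \<Longrightarrow> u + v \<in> D g"
    "\<And>c v. v \<in> D g \<Longrightarrow> c \<cdot>\<^sub>m v \<in> D g" "D g \<subseteq> carrier ?U" if "g \<in> carrier G" for g
    using bspec[OF subD that] by (simp_all add: VectorSpace.subspace_def LinearCombinations.submodule_def)
  have pos_sub: "a \<in> D g" if g: "g \<in> carrier G" and a: "a \<in> position_grading G n d g" for g a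
  proof (rule UJ_span[OF position_gradingD(1)[OF a g] sub(1,2)[OF g]])
    fix i j assume ij: "i \<le> j" "j < n"
    show "a $$ (i, j) \<cdot>\<^sub>m matrix_unit n i j \<in> D g"
    proof (cases "a $$ (i, j) = 0")
      case True
      have "0 \<cdot>\<^sub>m matrix_unit n i j = (0\<^sub>m n n :: 'k mat)" by (intro eq_matI) auto
      then show ?thesis using True sub(1)[OF g] by simp
    next
      case False
      then have "d i j = g" by (rule position_gradingD(2)[OF a g ij])
      then show ?thesis using d[OF ij] sub(3)[OF g] by auto
    qed
  qed
  have sub_pos: "a \<in> position_grading G n d g" if g: "g \<in> carrier G" and a: "a \<in> D g" for g a
  proof -
    have aU: "a \<in> carrier ?U" using sub(4)[OF g] a by blast
    let ?P = "\<lambda>f. f \<in> Pi\<^sub>E (carrier G) D \<and> finite {h \<in> carrier G. f h \<noteq> \<zero>\<^bsub>?U\<^esub>} \<and>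
        a = finsum ?U f {h \<in> carrier G. f h \<noteq> \<zero>\<^bsub>?U\<^esub>}"
    \<comment> \<open>Two decompositions of the same \<open>a\<close>: one concentrated in degree
      \<open>g\<close>, one splitting \<open>a\<close> by positions. By uniqueness they agree, so
      \<open>a\<close> equals its own part of degree \<open>g\<close>.\<close>
    let ?f1 = "\<lambda>h\<in>carrier G. if h = g then a else 0\<^sub>m n n"
    let ?f2 = "\<lambda>h\<in>carrier G. degree_part n d a h"
    have ex: "\<exists>!f. ?P f" by (rule bspec[OF exD aU])
    have "?P ?f1"
    proof (intro conjI)
      show "?f1 \<in> Pi\<^sub>E (carrier G) D" using sub(1) a by auto
      have S: "{h \<in> carrier G. ?f1 h \<noteq> \<zero>\<^bsub>?U\<^esub>} = (if a = 0\<^sub>m n n then {} else {g})"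
        using g by auto
      then show "finite {h \<in> carrier G. ?f1 h \<noteq> \<zero>\<^bsub>?U\<^esub>}" by simp
      interpret abelian_monoid ?U by (rule UJ_abelian_monoid)
      show "a = finsum ?U ?f1 {h \<in> carrier G. ?f1 h \<noteq> \<zero>\<^bsub>?U\<^esub>}"
        unfolding S using aU g finsum_insert[of "{}" g ?f1] by (auto simp: carrier_UJ_iff)
    qed
    moreover have "?P ?f2"
    proof (intro conjI)
      have "degree_part n d a h \<in> D h" if "h \<in> carrier G" for h
        by (rule pos_sub[OF that degree_part_mem[OF aU that]])
      then show "?f2 \<in> Pi\<^sub>E (carrier G) D" by auto
      have S: "{h \<in> carrier G. ?f2 h \<noteq> \<zero>\<^bsub>?U\<^esub>} = {h \<in> carrier G. degree_part n d a h \<noteq> \<zero>\<^bsub>?U\<^esub>}"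
        by auto
      note dec = degree_part_decomposition[OF aU dc]
      show "finite {h \<in> carrier G. ?f2 h \<noteq> \<zero>\<^bsub>?U\<^esub>}" unfolding S by (rule dec(1))
      show "a = finsum ?U ?f2 {h \<in> carrier G. ?f2 h \<noteq> \<zero>\<^bsub>?U\<^esub>}" unfolding S by (rule dec(2)[symmetric])
    qed
    ultimately have "?f1 = ?f2" using ex by blast
    from fun_cong[OF this, of g] have "a = degree_part n d a g" using g by simp
    then show ?thesis using degree_part_mem[OF aU g, of d] by simp
  qed
  show D_eq: "D = position_grading G n d"
  proof (rule extensionalityI[of _ "carrier G"])
    show "D \<in> extensional (carrier G)" by (rule extD)
    show "position_grading G n d \<in> extensional (carrier G)" by (simp add: position_grading_def)
    show "D g = position_grading G n d g" if "g \<in> carrier G" for g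
      using pos_sub[OF that] sub_pos[OF that] by blast
  qed
  \<comment> \<open>A product of homogeneous elements lies in the component of the product degree,
    and a nonzero entry reveals that degree.\<close>
  have deg: "d i k = g \<otimes>\<^bsub>G\<^esub> h" if "x \<in> D g" "y \<in> D h" "g \<in> carrier G" "h \<in> carrier G"
    "jordan_prod x y $$ (i, k) \<noteq> 0" "i \<le> k" "k < n" for x y g h i k
  proof -
    have "x \<otimes>\<^bsub>?U\<^esub> y \<in> D (g \<otimes>\<^bsub>G\<^esub> h)" using multD that(1-4) by blast
    then have "jordan_prod x y \<in> position_grading G n d (g \<otimes>\<^bsub>G\<^esub> h)"
      using sub_pos[OF closed[OF that(3,4)]] by simp
    then show ?thesis
      using closed[OF that(3,4)] that(6,7,5) by (rule position_gradingD(2))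
  qed
  fix i j k assume ijk: "i \<le> j" "j \<le> k" "k < n"
  note nz = jordan_prod_matrix_unit_chain_nonzero[OF two ijk]
  show "d i k = d i j \<otimes>\<^bsub>G\<^esub> d j k"
    by (rule deg[OF _ _ _ _ nz(1)]) (use d ijk in auto)
  show "d i k = d j k \<otimes>\<^bsub>G\<^esub> d i j"
    by (rule deg[OF _ _ _ _ nz(2)]) (use d ijk in auto)
qed

section \<open>Commutativity of the support\<close>

lemma support_position_grading:
  assumes "g \<in> grading_support G (UJ n) (position_grading G n d :: 'g \<Rightarrow> 'k::field mat set)"
  obtains i j where "i \<le> j" "j < n" "g = d i j"
proof -
  let ?D = "position_grading G n d :: 'g \<Rightarrow> 'k mat set"
  have g: "g \<in> carrier G" "?D g \<noteq> {0\<^sub>m n n}"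
    using assms by (auto simp: grading_support_def)
  have "0\<^sub>m n n \<in> ?D g" by (rule position_gradingI[OF g(1)]) (auto simp: carrier_UJ_iff)
  then obtain a where a: "a \<in> ?D g" "a \<noteq> 0\<^sub>m n n" using g(2) by blast
  have "\<exists>i j. i \<le> j \<and> j < n \<and> a $$ (i, j) \<noteq> 0"
  proof (rule ccontr)
    assume "\<not> ?thesis"
    then have "a = 0\<^sub>m n n"
      using position_gradingD(1)[OF a(1) g(1)] by (intro UJ_eqI[of _ n]) (auto simp: carrier_UJ_iff)
    then show False using a by simp
  qed
  then show ?thesis using that position_gradingD(2)[OF a(1) g(1)] by blast
qed

text \<open>Superdiagonal degrees generate all the others, so it suffices that any two of them
  commute; the centraliser argument then passes from steps to intervals, once for each
  factor.\<close>

lemma (in group) path_degrees_commute: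
  fixes d :: "nat \<Rightarrow> nat \<Rightarrow> 'a"
  assumes d: "\<And>i j. i \<le> j \<Longrightarrow> j < n \<Longrightarrow> d i j \<in> carrier G"
    and mult: "\<And>i j k. i \<le> j \<Longrightarrow> j \<le> k \<Longrightarrow> k < n \<Longrightarrow> d i k = d i j \<otimes> d j k"
    and comm: "\<And>i j k. i \<le> j \<Longrightarrow> j \<le> k \<Longrightarrow> k < n \<Longrightarrow> d i k = d j k \<otimes> d i j"
    and ij: "i \<le> j" "j < n" and kl: "k \<le> l" "l < n"
  shows "d i j \<otimes> d k l = d k l \<otimes> d i j"
proof -
  \<comment> \<open>\<open>?x\<close> commutes with the gap degree \<open>?y\<close> and with
    \<open>?y \<otimes> ?z\<close>, since both of these intervals start where that of
    \<open>?x\<close> ends; cancelling \<open>?y\<close> leaves \<open>?z\<close>.\<close>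
  have apart: "d i j \<otimes> d k l = d k l \<otimes> d i j" if h: "i \<le> j" "j \<le> k" "k \<le> l" "l < n" for i j k l
  proof -
    let ?x = "d i j" and ?y = "d j k" and ?z = "d k l"
    have c: "?x \<in> carrier G" "?y \<in> carrier G" "?z \<in> carrier G" using h by (simp_all add: d)
    have xy: "?x \<otimes> ?y = ?y \<otimes> ?x" using mult[of i j k] comm[of i j k] h by simp
    have "?x \<otimes> d j l = d j l \<otimes> ?x" using mult[of i j l] comm[of i j l] h by simp
    then have "?x \<otimes> (?y \<otimes> ?z) = (?y \<otimes> ?z) \<otimes> ?x" using mult[of j k l] h by simp
    then have "?y \<otimes> (?x \<otimes> ?z) = ?y \<otimes> (?z \<otimes> ?x)" using c xy by (metis m_assoc)
    then show ?thesis using c by simp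
  qed
  have steps: "d k (Suc k) \<otimes> d l (Suc l) = d l (Suc l) \<otimes> d k (Suc k)" if "Suc k < n" "Suc l < n" for k l
    using apart[of k "Suc k" l "Suc l"] apart[of l "Suc l" k "Suc k"] that
    by (cases k l rule: linorder_cases) auto
  \<comment> \<open>Used twice: with \<open>z\<close> a superdiagonal degree, and with
    \<open>z = d i j\<close>.\<close>
  have gen: "z \<otimes> d i j = d i j \<otimes> z"
    if z: "z \<in> carrier G" "\<And>k. Suc k < n \<Longrightarrow> z \<otimes> d k (Suc k) = d k (Suc k) \<otimes> z"
      and ij: "i \<le> j" "j < n" for z i j
    using ij
  proof (induction j rule: dec_induct)
    case base
    \<comment> \<open>\<open>d i i\<close> is an idempotent of the group, hence the
      identity.\<close>
    have "d i i = \<one>" using mult[of i i i] d[of i i] base by (simp add: r_cancel_one')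
    then show ?case using z by simp
  next
    case (step m)
    have c: "d i m \<in> carrier G" "d m (Suc m) \<in> carrier G" using step by (auto intro!: d)
    have "z \<otimes> d i m = d i m \<otimes> z" using step by simp
    moreover have "d i (Suc m) = d i m \<otimes> d m (Suc m)" using step by (intro mult) auto
    ultimately show ?case using z(1) z(2)[OF step(4)] c by (metis m_assoc)
  qed
  show ?thesis
  proof (rule gen[OF d[OF ij] _ kl])
    fix m assume m: "Suc m < n"
    have "d m (Suc m) \<otimes> d i j = d i j \<otimes> d m (Suc m)"
      by (rule gen[OF d steps ij]) (use m in auto)
    then show "d i j \<otimes> d m (Suc m) = d m (Suc m) \<otimes> d i j" by simp
  qed
qed

section \<open>Gradings determined by a tuple\<close>

context comm_monoid
begin

lemma unit_degree_closed:
  assumes "\<eta> \<in> group_tuples G (n - 1)" "j < n"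
  shows "unit_degree G \<eta> i j \<in> carrier G"
  unfolding unit_degree_def
proof (intro finprod_closed Pi_I)
  fix k assume "k \<in> {i..<j}"
  then show "\<eta> ! k \<in> carrier G"
    using assms nth_mem[of k \<eta>] by (auto simp: group_tuples_def)
qed

lemma unit_degree_mult:
  assumes "\<eta> \<in> group_tuples G (n - 1)" "i \<le> j" "j \<le> k" "k < n"
  shows "unit_degree G \<eta> i k = unit_degree G \<eta> i j \<otimes> unit_degree G \<eta> j k"
proof -
  have "\<eta> ! m \<in> carrier G" if "m < k" for m
    using assms that nth_mem[of m \<eta>] by (auto simp: group_tuples_def)
  moreover have "{i..<k} = {i..<j} \<union> {j..<k}" using assms by auto
  ultimately show ?thesis
    unfolding unit_degree_def using assms by (simp add: finprod_Un_disjoint Pi_iff)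
qed

lemma unit_degree_step:
  assumes "\<eta> \<in> group_tuples G (n - 1)" "Suc i < n"
  shows "unit_degree G \<eta> i (Suc i) = \<eta> ! i"
proof -
  have "\<eta> ! i \<in> carrier G"
    using assms nth_mem[of i \<eta>] by (auto simp: group_tuples_def)
  then show ?thesis
    unfolding unit_degree_def by (simp add: finprod_insert[of "{}" i, simplified])
qed

lemma grading_of_tuple_elementary:
  assumes "\<eta> \<in> group_tuples G (n - 1)"
  shows "grading_of_tuple G n \<eta> \<in> (elementary_gradings G n :: ('a \<Rightarrow> 'k::field mat set) set)"
  unfolding grading_of_tuple_eq
proof (rule position_grading_elementary)
  fix i j k assume ijk: "i \<le> j" "j \<le> k" "k < n"
  show "unit_degree G \<eta> i k = unit_degree G \<eta> i j \<otimes> unit_degree G \<eta> j k"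
    by (rule unit_degree_mult[OF assms ijk])
  then show "unit_degree G \<eta> i k = unit_degree G \<eta> j k \<otimes> unit_degree G \<eta> i j"
    using unit_degree_closed[OF assms, of j i] unit_degree_closed[OF assms, of k j] ijk by (simp add: m_comm)
qed (use assms unit_degree_closed in auto)

end

text \<open>Multiplicativity along \<open>i \<le> j \<le> k\<close> makes every degree a product of
  superdiagonal degrees, and these form the tuple.\<close>

lemma (in comm_group) elementary_grading_is_grading_of_tuple:
  fixes D :: "'a \<Rightarrow> 'k::field mat set"
  assumes two: "(2::'k) \<noteq> 0" and D: "D \<in> elementary_gradings G n"
  obtains \<eta> where "\<eta> \<in> group_tuples G (n - 1)" "D = grading_of_tuple G n \<eta>"
proof -
  obtain d where D_eq: "D = position_grading G n d"
    and d: "\<And>i j. i \<le> j \<Longrightarrow> j < n \<Longrightarrow> d i j \<in> carrier G"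
    and mult: "\<And>i j k. i \<le> j \<Longrightarrow> j \<le> k \<Longrightarrow> k < n \<Longrightarrow> d i k = d i j \<otimes> d j k"
    and "\<And>i j k. i \<le> j \<Longrightarrow> j \<le> k \<Longrightarrow> k < n \<Longrightarrow> d i k = d j k \<otimes> d i j"
    using elementary_grading_is_position_grading[OF two D m_closed] by blast
  define \<eta> where "\<eta> = map (\<lambda>i. d i (Suc i)) [0..<n - 1]"
  have \<eta>: "\<eta> \<in> group_tuples G (n - 1)"
    using d by (auto simp: \<eta>_def group_tuples_def)
  have "d i j = unit_degree G \<eta> i j" if "i \<le> j" "j < n" for i j
    using that
  proof (induction j rule: dec_induct)
    case base
    have "d i i = \<one>" using mult[of i i i] d[of i i] base by (simp add: r_cancel_one')
    then show ?case by (simp add: unit_degree_def)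
  next
    case (step m)
    have "unit_degree G \<eta> i (Suc m) = unit_degree G \<eta> i m \<otimes> \<eta> ! m"
      using unit_degree_mult[OF \<eta>, of i m "Suc m"] unit_degree_step[OF \<eta>, of m] step by simp
    also have "\<eta> ! m = d m (Suc m)"
    proof -
      have "m < n - 1" using step by simp
      then show ?thesis by (simp add: \<eta>_def)
    qed
    also have "unit_degree G \<eta> i m \<otimes> d m (Suc m) = d i m \<otimes> d m (Suc m)" using step by simp
    also have "\<dots> = d i (Suc m)" using step by (intro mult[symmetric]) auto
    finally show ?case by simp
  qed
  then have "D = grading_of_tuple G n \<eta>"
    unfolding D_eq grading_of_tuple_eq by (rule position_grading_cong)
  with \<eta> show ?thesis by (rule that)
qed

subsection \<open>Automorphisms of the Jordan algebra of upper triangular matrices\<close>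

lemma jordan_square_zero_diag:
  assumes "(2::'k::field) \<noteq> 0" "(x :: 'k mat) \<in> carrier (UJ n)" "jordan_prod x x = 0\<^sub>m n n" "k < n"
  shows "x $$ (k, k) = 0"
  using jordan_prod_diag[OF assms(2,2,4)] assms by simp

text \<open>As \<open>jordan_prod x x\<close> is twice the square, \<open>x\<close> is an ordinary
  idempotent; being strictly triangular it is also nilpotent, hence zero.\<close>

lemma strict_idempotent_zero:
  assumes two: "(2::'k::field) \<noteq> 0" and x: "(x :: 'k mat) \<in> carrier (UJ n)"
    and idem: "jordan_prod x x = x + x" and diag: "\<And>k. k < n \<Longrightarrow> x $$ (k, k) = 0"
  shows "x = 0\<^sub>m n n"
proof -
  have "i \<le> j \<Longrightarrow> j < n \<Longrightarrow> x $$ (i, j) = 0" for i j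
  \<comment> \<open>Induction on the distance to the diagonal: in each summand either
    \<open>k = j\<close> and \<open>x $$ (j, j) = 0\<close>, or \<open>(i, k)\<close> is closer to
    the diagonal than \<open>(i, j)\<close>.\<close>
  proof (induction "j - i" arbitrary: i j rule: less_induct)
    case less
    have dims: "x \<in> carrier_mat n n" using x by (rule UJ_carrier_mat)
    have "2 * x $$ (i, j) = (x + x) $$ (i, j)" using dims less.prems by simp
    also have "\<dots> = (\<Sum>k=i..j. x $$ (i, k) * x $$ (k, j) + x $$ (i, k) * x $$ (k, j))"
      using jordan_prod_index_UJ[OF x x, of i j] less.prems idem by simp
    also have "\<dots> = 0"
    proof (rule sum.neutral, rule ballI)
      fix k assume k: "k \<in> {i..j}"
      have "x $$ (i, k) * x $$ (k, j) = 0"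
      proof (cases "k = j")
        case True
        then show ?thesis using diag less.prems by simp
      next
        case False
        then have "x $$ (i, k) = 0" using k less.prems by (intro less.hyps) auto
        then show ?thesis by simp
      qed
      then show "x $$ (i, k) * x $$ (k, j) + x $$ (i, k) * x $$ (k, j) = 0" by simp
    qed
    finally show ?case using two by simp
  qed
  then show ?thesis
    using x by (intro UJ_eqI[of _ n]) (auto simp: carrier_UJ_iff)
qed

text \<open>An injective walk on a path cannot turn back, so the direction of its first step
  persists, and the length of the path leaves one starting point for each direction.\<close>

lemma path_automorphism_cases:
  fixes \<tau> :: "nat \<Rightarrow> nat"
  assumes inj: "inj_on \<tau> {..<n}" and range: "\<And>k. k < n \<Longrightarrow> \<tau> k < n"
    and adj: "\<And>k. Suc k < n \<Longrightarrow> \<tau> (Suc k) = Suc (\<tau> k) \<or> \<tau> k = Suc (\<tau> (Suc k))"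
  shows "(\<forall>k<n. \<tau> k = k) \<or> (\<forall>k<n. \<tau> k = n - Suc k)"
proof (cases "n \<le> 1")
  case True
  then show ?thesis using range by (cases n) auto
next
  case False
  then have n: "1 < n" by simp
  have no_turn: "\<tau> (Suc (Suc k)) \<noteq> \<tau> k" if "Suc (Suc k) < n" for k
    using inj_onD[OF inj, of "Suc (Suc k)" k] that by auto
  have "\<tau> 1 = Suc (\<tau> 0) \<or> \<tau> 0 = Suc (\<tau> 1)" using adj[of 0] n by simp
  then show ?thesis
  proof
    assume up: "\<tau> 1 = Suc (\<tau> 0)"
    have step: "Suc k < n \<Longrightarrow> \<tau> (Suc k) = Suc (\<tau> k)" for k
    proof (induction k)
      case (Suc k)
      then show ?case using adj[of "Suc k"] no_turn[of k] by auto
    qed (use up in simp)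
    have add: "k < n \<Longrightarrow> \<tau> k = \<tau> 0 + k" for k
      by (induction k) (use step in auto)
    have "\<tau> 0 = 0" using add[of "n - 1"] range[of "n - 1"] n by simp
    then show ?thesis using add by simp
  next
    assume down: "\<tau> 0 = Suc (\<tau> 1)"
    have step: "Suc k < n \<Longrightarrow> \<tau> k = Suc (\<tau> (Suc k))" for k
    proof (induction k)
      case (Suc k)
      then show ?case using adj[of "Suc k"] no_turn[of k] by auto
    qed (use down in simp)
    \<comment> \<open>Written as a sum to avoid truncated subtraction; at \<open>n - 1\<close> it
      forces \<open>\<tau> 0\<close> to be the largest index.\<close>
    have add: "k < n \<Longrightarrow> \<tau> k + k = \<tau> 0" for k
    proof (induction k)
      case (Suc k)
      then show ?case using step[of k] by simp
    qed simp
    have "\<tau> 0 = n - 1" using add[of "n - 1"] range[of 0] n by simp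
    then have "\<tau> k = n - Suc k" if "k < n" for k using add[OF that] by simp
    then show ?thesis by blast
  qed
qed

text \<open>The disjuncts correspond to the identity and to the reversal of the indices. Nonzero
  superdiagonal entries are the form in which a comparison of degrees can use this.\<close>

lemma UJ_automorphism_superdiag:
  fixes \<phi> :: "'k::field mat \<Rightarrow> 'k mat"
  assumes two: "(2::'k) \<noteq> 0"
    and hom: "\<phi> \<in> LinearCombinations.module_hom class_ring (UJ n) (UJ n)"
    and bij: "bij_betw \<phi> (carrier (UJ n)) (carrier (UJ n))"
    and mult: "\<forall>x\<in>carrier (UJ n). \<forall>y\<in>carrier (UJ n). \<phi> (x \<otimes>\<^bsub>UJ n\<^esub> y) = \<phi> x \<otimes>\<^bsub>UJ n\<^esub> \<phi> y"
  shows "(\<forall>k. Suc k < n \<longrightarrow> \<phi> (matrix_unit n k (Suc k)) $$ (k, Suc k) \<noteq> 0) \<or>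
    (\<forall>k. Suc k < n \<longrightarrow> \<phi> (matrix_unit n (n - Suc (Suc k)) (n - Suc k)) $$ (k, Suc k) \<noteq> 0)"
proof -
  let ?U = "UJ n :: ('k, 'k mat) module" and ?e = "matrix_unit n :: nat \<Rightarrow> nat \<Rightarrow> 'k mat"
  have U: "\<phi> x \<in> carrier ?U" if "x \<in> carrier ?U" for x
    using hom that by (auto simp: LinearCombinations.module_hom_def)
  have add: "\<phi> (x + y) = \<phi> x + \<phi> y" if "x \<in> carrier ?U" "y \<in> carrier ?U" for x y
    using hom that by (auto simp: LinearCombinations.module_hom_def)
  have smult: "\<phi> (c \<cdot>\<^sub>m x) = c \<cdot>\<^sub>m \<phi> x" if "x \<in> carrier ?U" for c x
    using hom that by (auto simp: LinearCombinations.module_hom_def)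
  have mul: "\<phi> (jordan_prod x y) = jordan_prod (\<phi> x) (\<phi> y)" if "x \<in> carrier ?U" "y \<in> carrier ?U" for x y
    using mult that by simp
  have zeroU: "0\<^sub>m n n \<in> carrier ?U" by (auto simp: carrier_UJ_iff)
  have eU: "?e i j \<in> carrier ?U" if "i \<le> j" for i j by (rule matrix_unit_UJ[OF that])
  have zero: "\<phi> (0\<^sub>m n n) = 0\<^sub>m n n"
  proof -
    have "0 \<cdot>\<^sub>m x = 0\<^sub>m n n" if "x \<in> carrier ?U" for x :: "'k mat"
      using that by (intro eq_matI) (auto simp: carrier_UJ_iff)
    then show ?thesis using smult[OF zeroU, of 0] zeroU U by metis
  qed
  define f where "f i = \<phi> (?e i i)" for i
  have fU: "f i \<in> carrier ?U" for i by (simp add: f_def U eU)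
  \<comment> \<open>The Jordan product carries no factor one half, so an idempotent \<open>e\<close>
    satisfies \<open>jordan_prod e e = e + e\<close>.\<close>
  have idem: "jordan_prod (f i) (f i) = f i + f i" if "i < n" for i
  proof -
    have "jordan_prod (?e i i) (?e i i) = ?e i i + ?e i i"
      using that by (simp add: jordan_prod_matrix_unit)
    then show ?thesis using mul[OF eU eU, of i i i i] add[OF eU eU, of i i i i] by (simp add: f_def)
  qed
  have orth: "f i $$ (k, k) = 0 \<or> f j $$ (k, k) = 0" if "i < n" "j < n" "i \<noteq> j" "k < n" for i j k
  proof -
    have "jordan_prod (?e i i) (?e j j) = 0\<^sub>m n n"
      using that by (simp add: jordan_prod_matrix_unit)
    then have "jordan_prod (f i) (f j) = 0\<^sub>m n n"
      using mul[OF eU eU, of i i j j] zero by (simp add: f_def)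
    then show ?thesis using jordan_prod_diag[OF fU fU \<open>k < n\<close>, of i j] that two by simp
  qed
  \<comment> \<open>A vanishing diagonal would make \<open>f i\<close> zero by
    \<open>strict_idempotent_zero\<close>, against injectivity of \<open>\<phi>\<close>.\<close>
  have "\<exists>k<n. f i $$ (k, k) \<noteq> 0" if i: "i < n" for i
  proof (rule ccontr)
    assume "\<not> ?thesis"
    then have "f i = 0\<^sub>m n n"
      by (intro strict_idempotent_zero[OF two fU idem[OF i]]) auto
    then have "\<phi> (?e i i) = \<phi> (0\<^sub>m n n)" using zero by (simp add: f_def)
    then have "?e i i = 0\<^sub>m n n"
      using bij zeroU eU[of i i] by (auto simp: bij_betw_def dest: inj_onD)
    then show False using matrix_unit_nonzero[OF i i, where 'a='k] by simp
  qed
  then have "\<forall>i. \<exists>k. i < n \<longrightarrow> k < n \<and> f i $$ (k, k) \<noteq> 0" by blast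
  then obtain \<sigma> where \<sigma>: "\<And>i. i < n \<Longrightarrow> \<sigma> i < n" "\<And>i. i < n \<Longrightarrow> f i $$ (\<sigma> i, \<sigma> i) \<noteq> 0"
    by metis
  \<comment> \<open>Two indices with the same value of \<open>\<sigma>\<close> would contradict
    \<open>orth\<close>; by finiteness \<open>\<sigma>\<close> is a permutation.\<close>
  have inj: "inj_on \<sigma> {..<n}"
    using \<sigma> orth by (intro inj_onI) (metis lessThan_iff)
  have surj: "\<sigma> ` {..<n} = {..<n}"
    using \<sigma>(1) by (intro endo_inj_surj inj) auto
  \<comment> \<open>At \<open>\<sigma> i\<close> the entry is a nonzero solution of
    \<open>t = t * t\<close>; every other position is \<open>\<sigma> j\<close> for some
    \<open>j \<noteq> i\<close>, where \<open>orth\<close> makes it vanish.\<close>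
  have f_diag: "f i $$ (k, k) = (if k = \<sigma> i then 1 else 0)" if "i < n" "k < n" for i k
  proof (cases "k = \<sigma> i")
    case True
    have "(f i + f i) $$ (k, k) = 2 * f i $$ (k, k)"
      using UJ_carrier_mat[OF fU[of i]] that by simp
    then have "2 * f i $$ (k, k) = 2 * (f i $$ (k, k) * f i $$ (k, k))"
      using jordan_prod_diag[OF fU fU that(2), of i i] idem[OF that(1)] by simp
    then show ?thesis using True \<sigma>(2)[OF that(1)] two by simp
  next
    case False
    obtain j where "j < n" "k = \<sigma> j" using surj \<open>k < n\<close> by blast
    then show ?thesis using False orth[OF that(1), of j k] \<sigma>(2)[of j] that by auto
  qed
  \<comment> \<open>\<open>\<tau> k\<close> is the index whose idempotent has its diagonal 1 at
    position \<open>k\<close>.\<close>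
  define \<tau> where "\<tau> = inv_into {..<n} \<sigma>"
  have \<tau>: "\<tau> k < n" "\<sigma> (\<tau> k) = k" if "k < n" for k
    using that surj inv_into_into[of k \<sigma> "{..<n}"] f_inv_into_f[of k \<sigma> "{..<n}"] by (auto simp: \<tau>_def)
  have \<tau>\<sigma>: "\<tau> (\<sigma> i) = i" if "i < n" for i
    using that inj by (simp add: \<tau>_def)
  \<comment> \<open>Such a matrix unit has Jordan square zero, and so does its image.\<close>
  have diag0: "\<phi> (?e i j) $$ (k, k) = 0" if "i < j" "j < n" "k < n" for i j k
  proof -
    have "jordan_prod (?e i j) (?e i j) = 0\<^sub>m n n"
      using that by (simp add: jordan_prod_matrix_unit)
    then have "jordan_prod (\<phi> (?e i j)) (\<phi> (?e i j)) = 0\<^sub>m n n"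
      using mul[OF eU eU, of i j i j] zero that by simp
    then show ?thesis using that by (intro jordan_square_zero_diag[OF two U[OF eU]]) auto
  qed
  \<comment> \<open>The unit is a product of two strictly triangular ones. Their images have zero
    diagonal by \<open>diag0\<close>, which kills the superdiagonal of the product.\<close>
  have far0: "\<phi> (?e i j) $$ (k, Suc k) = 0" if "Suc i < j" "j < n" "Suc k < n" for i j k
  proof -
    have "jordan_prod (?e i (Suc i)) (?e (Suc i) j) = ?e i j"
      using that right_add_zero_mat[OF matrix_unit_carrier_mat] by (simp add: jordan_prod_matrix_unit)
    then have "\<phi> (?e i j) = jordan_prod (\<phi> (?e i (Suc i))) (\<phi> (?e (Suc i) j))"
      using mul[OF eU eU, of i "Suc i" "Suc i" j] that by simp
    then show ?thesis
      using that by (simp add: jordan_prod_superdiag[OF U[OF eU] U[OF eU]] diag0)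
  qed
  \<comment> \<open>Surjectivity of \<open>\<phi>\<close> provides \<open>i\<close> with a nonzero
    entry at \<open>(k, Suc k)\<close>; the idempotents \<open>f i\<close> and
    \<open>f (Suc i)\<close> then locate this entry.\<close>
  have adjacent: "\<exists>i. Suc i < n \<and> \<phi> (?e i (Suc i)) $$ (k, Suc k) \<noteq> 0 \<and>
      (\<tau> k = i \<and> \<tau> (Suc k) = Suc i \<or> \<tau> k = Suc i \<and> \<tau> (Suc k) = i)" if k: "Suc k < n" for k
  proof -
    have "\<exists>i. Suc i < n \<and> \<phi> (?e i (Suc i)) $$ (k, Suc k) \<noteq> 0"
    proof (rule ccontr)
      assume "\<not> ?thesis"
      then have near0: "\<phi> (?e i (Suc i)) $$ (k, Suc k) = 0" if "Suc i < n" for i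
        using that by blast
      \<comment> \<open>If all these entries vanished, the entry of \<open>\<phi> x\<close> at
        \<open>(k, Suc k)\<close> would depend only on the diagonal of \<open>x\<close>, and
        \<open>\<phi>\<close> permutes diagonals. Both identities are additive, so checking them on
        multiples of matrix units suffices.\<close>
      let ?V = "{x \<in> carrier ?U. (\<forall>l<n. \<phi> x $$ (l, l) = x $$ (\<tau> l, \<tau> l)) \<and>
          \<phi> x $$ (k, Suc k) = (\<Sum>i<n. x $$ (i, i) * f i $$ (k, Suc k))}"
      have "?e k (Suc k) \<in> \<phi> ` carrier ?U"
        using bij eU[of k "Suc k"] by (simp add: bij_betw_def)
      then obtain x where x: "x \<in> carrier ?U" "\<phi> x = ?e k (Suc k)" by (metis imageE)
      have "x \<in> ?V"
      proof (rule UJ_span[OF x(1)])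
        show "0\<^sub>m n n \<in> ?V" using zeroU zero \<tau>(1) k by simp
      next
        fix u v assume uv: "u \<in> ?V" "v \<in> ?V"
        then have c: "u \<in> carrier ?U" "v \<in> carrier ?U" by auto
        then have m: "u \<in> carrier_mat n n" "v \<in> carrier_mat n n"
          "\<phi> u \<in> carrier_mat n n" "\<phi> v \<in> carrier_mat n n"
          using UJ_carrier_mat U by blast+
        have "u + v \<in> carrier ?U" using UJ_add_closed[OF c] by simp
        then show "u + v \<in> ?V"
          using uv m \<tau>(1) k by (simp add: add[OF c] sum.distrib algebra_simps)
      next
        fix i j assume ij: "i \<le> j" "j < n"
        let ?c = "x $$ (i, j)"
        have m: "\<phi> (?e i j) \<in> carrier_mat n n" using ij by (intro UJ_carrier_mat U eU)
        have cU: "?c \<cdot>\<^sub>m ?e i j \<in> carrier ?U" using UJ_smult_closed[OF eU[OF ij(1)]] by simp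
        show "?c \<cdot>\<^sub>m ?e i j \<in> ?V"
        proof (cases "i = j")
          case True
          have "\<phi> (?e i i) $$ (l, l) = ?e i i $$ (\<tau> l, \<tau> l)" if "l < n" for l
            using f_diag[of i l] \<tau>[OF that] \<tau>\<sigma>[of i] ij True that by (auto simp: f_def)
          moreover have "(\<Sum>l<n. (?c \<cdot>\<^sub>m ?e i i) $$ (l, l) * f l $$ (k, Suc k))
              = (\<Sum>l<n. if l = i then ?c * f i $$ (k, Suc k) else 0)"
            using ij by (intro sum.cong) auto
          ultimately show ?thesis
            using True ij m cU \<tau>(1) k by (simp add: smult[OF eU] f_def)
        next
          case False
          then have "i < j" using ij by simp
          have unit0: "\<phi> (?e i j) $$ (k, Suc k) = 0"
            using far0[of i j k] near0[of i] \<open>i < j\<close> ij k by (cases "j = Suc i") auto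
          have img: "\<phi> (?c \<cdot>\<^sub>m ?e i j) $$ (p, q) = ?c * \<phi> (?e i j) $$ (p, q)" if "p < n" "q < n" for p q
            using m that by (simp add: smult[OF eU[OF ij(1)]])
          have off: "(?c \<cdot>\<^sub>m ?e i j) $$ (l, l) = 0" if "l < n" for l
            using that False by auto
          have "\<phi> (?c \<cdot>\<^sub>m ?e i j) $$ (l, l) = (?c \<cdot>\<^sub>m ?e i j) $$ (\<tau> l, \<tau> l)" if "l < n" for l
            using img[OF that that] diag0[OF \<open>i < j\<close> ij(2) that] off[OF \<tau>(1)[OF that]] by (simp only: mult_zero_right)
          moreover have "\<phi> (?c \<cdot>\<^sub>m ?e i j) $$ (k, Suc k) =
              (\<Sum>l<n. (?c \<cdot>\<^sub>m ?e i j) $$ (l, l) * f l $$ (k, Suc k))"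
            using img[of k "Suc k"] unit0 k off by (simp del: index_smult_mat(1))
          ultimately show ?thesis using cU by blast
        qed
      qed
      then have V: "\<And>l. l < n \<Longrightarrow> \<phi> x $$ (l, l) = x $$ (\<tau> l, \<tau> l)"
        "\<phi> x $$ (k, Suc k) = (\<Sum>i<n. x $$ (i, i) * f i $$ (k, Suc k))" by auto
      \<comment> \<open>The image \<open>?e k (Suc k)\<close> of \<open>x\<close> has zero diagonal,
        hence so has \<open>x\<close>; but then the image would vanish at
        \<open>(k, Suc k)\<close>.\<close>
      have "x $$ (i, i) = 0" if "i < n" for i
        using V(1)[OF \<sigma>(1)[OF that]] x(2) \<sigma>(1)[OF that] \<tau>\<sigma>[OF that] by (simp split: if_splits)
      then have "\<phi> x $$ (k, Suc k) = 0" using V(2) by simp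
      then show False using x(2) k by simp
    qed
    then obtain i where i: "Suc i < n" "\<phi> (?e i (Suc i)) $$ (k, Suc k) \<noteq> 0" by blast
    \<comment> \<open>\<open>?e m m\<close> acts as a unit on \<open>?e i (Suc i)\<close>. After
      applying \<open>\<phi>\<close>, a nonzero entry at \<open>(k, Suc k)\<close> requires the
      diagonal of \<open>f m\<close> to be nonzero at \<open>k\<close> or
      \<open>Suc k\<close>.\<close>
    have hit: "\<sigma> m = k \<or> \<sigma> m = Suc k" if m: "m = i \<or> m = Suc i" for m
    proof (rule ccontr)
      assume "\<not> ?thesis"
      then have "f m $$ (k, k) = 0" "f m $$ (Suc k, Suc k) = 0"
        using f_diag[of m k] f_diag[of m "Suc k"] m i(1) k by auto
      moreover have "jordan_prod (?e m m) (?e i (Suc i)) = ?e i (Suc i)"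
        using m i(1) right_add_zero_mat[OF matrix_unit_carrier_mat] left_add_zero_mat[OF matrix_unit_carrier_mat]
        by (auto simp: jordan_prod_matrix_unit)
      then have "\<phi> (?e i (Suc i)) = jordan_prod (f m) (\<phi> (?e i (Suc i)))"
        using mul[OF eU eU, of m m i "Suc i"] by (simp add: f_def)
      moreover have "jordan_prod (f m) (\<phi> (?e i (Suc i))) $$ (k, Suc k) =
          (f m $$ (k, k) + f m $$ (Suc k, Suc k)) * \<phi> (?e i (Suc i)) $$ (k, Suc k)"
        using i(1) k by (simp add: jordan_prod_superdiag[OF fU U[OF eU]] diag0)
      ultimately show False using i(2) by simp
    qed
    have "\<sigma> i \<noteq> \<sigma> (Suc i)" using inj_onD[OF inj, of i "Suc i"] i(1) by auto
    then have "\<sigma> i = k \<and> \<sigma> (Suc i) = Suc k \<or> \<sigma> i = Suc k \<and> \<sigma> (Suc i) = k"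
      using hit[of i] hit[of "Suc i"] by auto
    then show ?thesis using i \<tau>\<sigma>[of i] \<tau>\<sigma>[of "Suc i"] by auto
  qed
  have "inj_on \<tau> {..<n}"
    by (rule inj_on_inverseI[of _ \<sigma>]) (use \<tau>(2) in auto)
  \<comment> \<open>By \<open>adjacent\<close>, \<open>\<tau>\<close> is an injective self-map of
    the path that preserves neighbours.\<close>
  then have "(\<forall>k<n. \<tau> k = k) \<or> (\<forall>k<n. \<tau> k = n - Suc k)"
    using \<tau>(1) adjacent by (intro path_automorphism_cases) force+
  then show ?thesis
  proof
    assume id: "\<forall>k<n. \<tau> k = k"
    have "\<phi> (?e k (Suc k)) $$ (k, Suc k) \<noteq> 0" if "Suc k < n" for k
      using adjacent[OF that] id that by auto
    then show ?thesis by blast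
  next
    assume rev: "\<forall>k<n. \<tau> k = n - Suc k"
    have "\<phi> (?e (n - Suc (Suc k)) (n - Suc k)) $$ (k, Suc k) \<noteq> 0" if k: "Suc k < n" for k
    proof -
      \<comment> \<open>As \<open>\<tau>\<close> decreases, the second orientation in
        \<open>adjacent\<close> holds, with
        \<open>i = \<tau> (Suc k) = n - Suc (Suc k)\<close>.\<close>
      have "\<tau> k = Suc (\<tau> (Suc k))" using rev k by simp
      then obtain i where "\<tau> (Suc k) = i" "\<tau> k = Suc i" "\<phi> (?e i (Suc i)) $$ (k, Suc k) \<noteq> 0"
        using adjacent[OF k] by auto
      then show ?thesis using rev k by simp
    qed
    then show ?thesis by blast
  qed
qed

subsection \<open>Reflection in the antidiagonal\<close>

text \<open>The transpose conjugated by the permutation that reverses the indices, so that upper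
  triangular matrices stay upper triangular.\<close>

definition antitranspose :: "nat \<Rightarrow> 'k::field mat \<Rightarrow> 'k mat" where
  "antitranspose n x = mat n n (\<lambda>(i, j). x $$ (n - Suc j, n - Suc i))"

lemma antitranspose_index [simp]:
  "i < n \<Longrightarrow> j < n \<Longrightarrow> antitranspose n x $$ (i, j) = x $$ (n - Suc j, n - Suc i)"
  by (simp add: antitranspose_def)

lemma antitranspose_dim [simp]: "dim_row (antitranspose n x) = n" "dim_col (antitranspose n x) = n"
  by (simp_all add: antitranspose_def)

lemma antitranspose_UJ: "x \<in> carrier (UJ n) \<Longrightarrow> antitranspose n x \<in> carrier (UJ n)"
  by (auto simp: carrier_UJ_iff)

lemma antitranspose_involution:
  assumes "x \<in> carrier (UJ n)"
  shows "antitranspose n (antitranspose n x) = x"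
  by (rule UJ_eqI[OF _ assms]) (use assms in \<open>auto simp: antitranspose_UJ\<close>)

text \<open>The reflection reverses associative products, and the Jordan product is symmetric in its
  factors.\<close>

lemma antitranspose_jordan_prod:
  assumes "x \<in> carrier (UJ n)" "y \<in> carrier (UJ n)"
  shows "antitranspose n (jordan_prod x y) = jordan_prod (antitranspose n x) (antitranspose n y)"
proof -
  have c: "x \<in> carrier_mat n n" "y \<in> carrier_mat n n" "antitranspose n x \<in> carrier_mat n n"
    "antitranspose n y \<in> carrier_mat n n"
    using assms by (auto intro: UJ_carrier_mat)
  show ?thesis
  proof (rule eq_matI)
    fix i j
    assume "i < dim_row (jordan_prod (antitranspose n x) (antitranspose n y))"
      "j < dim_col (jordan_prod (antitranspose n x) (antitranspose n y))"
    then have ij: "i < n" "j < n" by (auto simp: jordan_prod_def)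
    let ?g = "\<lambda>k. x $$ (n - Suc j, k) * y $$ (k, n - Suc i) + y $$ (n - Suc j, k) * x $$ (k, n - Suc i)"
    have "antitranspose n (jordan_prod x y) $$ (i, j) = (\<Sum>k<n. ?g k)"
      using ij c by (simp add: jordan_prod_index)
    \<comment> \<open>Reflecting the summation index as well gives the summands for the reflected
      matrices.\<close>
    also have "\<dots> = (\<Sum>k<n. ?g (n - Suc k))"
      by (rule sum.nat_diff_reindex[symmetric])
    also have "\<dots> = jordan_prod (antitranspose n x) (antitranspose n y) $$ (i, j)"
      unfolding jordan_prod_index[OF c(3,4) ij] using ij by (intro sum.cong) (auto simp: algebra_simps)
    finally show "antitranspose n (jordan_prod x y) $$ (i, j) =
      jordan_prod (antitranspose n x) (antitranspose n y) $$ (i, j)" .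
  qed (auto simp: jordan_prod_def)
qed

lemma rev_group_tuples: "rev \<eta> \<in> group_tuples G m \<longleftrightarrow> \<eta> \<in> group_tuples G m"
  by (simp add: group_tuples_def)

text \<open>Lengthening an interval by one on the right lengthens its mirror image by one on the
  left; commutativity reconciles the two orders.\<close>

lemma (in comm_monoid) unit_degree_rev:
  assumes \<eta>: "\<eta> \<in> group_tuples G (n - 1)" and ij: "i \<le> j" "j < n"
  shows "unit_degree G (rev \<eta>) i j = unit_degree G \<eta> (n - Suc j) (n - Suc i)"
  using ij
proof (induction j rule: dec_induct)
  case base
  then show ?case by (simp add: unit_degree_def)
next
  case (step m)
  \<comment> \<open>Left end of the mirror image of the lengthened interval.\<close>
  let ?a = "n - Suc (Suc m)"
  have \<eta>': "rev \<eta> \<in> group_tuples G (n - 1)" using \<eta> by (simp add: rev_group_tuples)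
  have a: "Suc ?a = n - Suc m" "Suc ?a \<le> n - Suc i" "n - Suc i < n" using step by auto
  have "unit_degree G (rev \<eta>) i (Suc m) = unit_degree G (rev \<eta>) i m \<otimes> rev \<eta> ! m"
    using unit_degree_mult[OF \<eta>', of i m "Suc m"] unit_degree_step[OF \<eta>', of m] step by simp
  also have "rev \<eta> ! m = \<eta> ! ?a"
    using \<eta> step by (simp add: group_tuples_def rev_nth)
  also have "\<eta> ! ?a = unit_degree G \<eta> ?a (Suc ?a)"
    using unit_degree_step[OF \<eta>, of ?a] a by simp
  also have "unit_degree G (rev \<eta>) i m = unit_degree G \<eta> (Suc ?a) (n - Suc i)"
    using step a by simp
  also have "unit_degree G \<eta> (Suc ?a) (n - Suc i) \<otimes> unit_degree G \<eta> ?a (Suc ?a) =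
      unit_degree G \<eta> ?a (Suc ?a) \<otimes> unit_degree G \<eta> (Suc ?a) (n - Suc i)"
    using a by (intro m_comm unit_degree_closed[OF \<eta>]) auto
  also have "\<dots> = unit_degree G \<eta> ?a (n - Suc i)"
    using a by (intro unit_degree_mult[OF \<eta>, symmetric]) auto
  finally show ?case .
qed

text \<open>The witness is \<open>antitranspose\<close>: it moves \<open>(i, j)\<close> to
  \<open>(n - Suc j, n - Suc i)\<close>, whose degree for the reversed tuple is the old degree of
  \<open>(i, j)\<close>.\<close>

lemma (in comm_monoid) graded_isomorphic_rev:
  assumes \<eta>: "\<eta> \<in> group_tuples G (n - 1)"
  shows "graded_isomorphic G class_ring (UJ n :: ('k::field, 'k mat) module) (grading_of_tuple G n \<eta>)
    (UJ n) (grading_of_tuple G n (rev \<eta>))"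
proof -
  let ?U = "UJ n :: ('k, 'k mat) module" and ?\<phi> = "antitranspose n :: 'k mat \<Rightarrow> 'k mat"
  \<comment> \<open>Stated for every tuple \<open>\<mu>\<close>: applied to
    \<open>rev \<eta>\<close> it gives the reverse inclusion, as reflection and \<open>rev\<close>
    are involutions.\<close>
  have into: "?\<phi> a \<in> grading_of_tuple G n (rev \<mu>) g"
    if \<mu>: "\<mu> \<in> group_tuples G (n - 1)" and g: "g \<in> carrier G" and a: "a \<in> grading_of_tuple G n \<mu> g"
    for \<mu> g a
    unfolding grading_of_tuple_eq
  proof (rule position_gradingI[OF g])
    note a' = position_gradingD[OF a[unfolded grading_of_tuple_eq] g]
    show "?\<phi> a \<in> carrier ?U" by (rule antitranspose_UJ[OF a'(1)])
    fix i j assume ij: "i \<le> j" "j < n" "?\<phi> a $$ (i, j) \<noteq> 0"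
    then have "unit_degree G \<mu> (n - Suc j) (n - Suc i) = g"
      by (intro a'(2)) auto
    then show "unit_degree G (rev \<mu>) i j = g"
      using unit_degree_rev[OF \<mu> ij(1,2)] by simp
  qed
  show ?thesis
    unfolding graded_isomorphic_def
  proof (intro bexI[of _ ?\<phi>] conjI ballI)
    show "?\<phi> \<in> LinearCombinations.module_hom class_ring ?U ?U"
      unfolding LinearCombinations.module_hom_def
    proof (intro CollectI conjI allI impI Pi_I)
      fix x y assume "x \<in> carrier ?U \<and> y \<in> carrier ?U"
      then show "?\<phi> (x \<oplus>\<^bsub>?U\<^esub> y) = ?\<phi> x \<oplus>\<^bsub>?U\<^esub> ?\<phi> y"
        by (intro eq_matI) (auto simp: carrier_UJ_iff)
    next
      fix c x assume "c \<in> carrier (class_ring :: 'k ring) \<and> x \<in> carrier ?U"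
      then show "?\<phi> (c \<odot>\<^bsub>?U\<^esub> x) = c \<odot>\<^bsub>?U\<^esub> ?\<phi> x"
        by (intro eq_matI) (auto simp: carrier_UJ_iff)
    qed (rule antitranspose_UJ)
    show "bij_betw ?\<phi> (carrier ?U) (carrier ?U)"
      by (rule bij_betw_byWitness[of _ ?\<phi>]) (auto simp: antitranspose_involution antitranspose_UJ)
    show "?\<phi> (x \<otimes>\<^bsub>?U\<^esub> y) = ?\<phi> x \<otimes>\<^bsub>?U\<^esub> ?\<phi> y" if "x \<in> carrier ?U" "y \<in> carrier ?U" for x y
      using antitranspose_jordan_prod[OF that] by simp
    show "?\<phi> ` grading_of_tuple G n \<eta> g = grading_of_tuple G n (rev \<eta>) g" if g: "g \<in> carrier G" for g
    proof
      show "?\<phi> ` grading_of_tuple G n \<eta> g \<subseteq> grading_of_tuple G n (rev \<eta>) g"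
        using into[OF \<eta> g] by blast
      show "grading_of_tuple G n (rev \<eta>) g \<subseteq> ?\<phi> ` grading_of_tuple G n \<eta> g"
      proof
        fix b assume b: "b \<in> (grading_of_tuple G n (rev \<eta>) g :: 'k mat set)"
        have "?\<phi> b \<in> grading_of_tuple G n \<eta> g"
          using into[OF _ g b] \<eta> by (simp add: rev_group_tuples)
        moreover have "b \<in> carrier ?U"
          using position_gradingD(1)[OF b[unfolded grading_of_tuple_eq] g] .
        ultimately show "b \<in> ?\<phi> ` grading_of_tuple G n \<eta> g"
          by (metis antitranspose_involution imageI)
      qed
    qed
  qed
qed

text \<open>Degrees are preserved, so a nonzero superdiagonal entry in the image of a superdiagonal
  unit identifies an entry of \<open>\<mu>\<close> with one of \<open>\<eta>\<close>;
  \<open>UJ_automorphism_superdiag\<close> supplies enough such pairs.\<close>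

lemma (in comm_monoid) graded_isomorphic_tuples:
  assumes two: "(2::'k::field) \<noteq> 0"
    and \<eta>: "\<eta> \<in> group_tuples G (n - 1)" and \<mu>: "\<mu> \<in> group_tuples G (n - 1)"
    and iso: "graded_isomorphic G class_ring (UJ n :: ('k, 'k mat) module) (grading_of_tuple G n \<eta>)
      (UJ n) (grading_of_tuple G n \<mu>)"
  shows "\<mu> = \<eta> \<or> \<mu> = rev \<eta>"
proof -
  obtain \<phi> :: "'k mat \<Rightarrow> 'k mat" where hom: "\<phi> \<in> LinearCombinations.module_hom class_ring (UJ n) (UJ n)"
    and bij: "bij_betw \<phi> (carrier (UJ n)) (carrier (UJ n))"
    and mult: "\<forall>x\<in>carrier (UJ n). \<forall>y\<in>carrier (UJ n). \<phi> (x \<otimes>\<^bsub>UJ n\<^esub> y) = \<phi> x \<otimes>\<^bsub>UJ n\<^esub> \<phi> y"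
    and graded: "\<forall>g\<in>carrier G. \<phi> ` grading_of_tuple G n \<eta> g = grading_of_tuple G n \<mu> g"
    using iso unfolding graded_isomorphic_def by blast
  have len: "length \<eta> = n - 1" "length \<mu> = n - 1" using \<eta> \<mu> by (auto simp: group_tuples_def)
  have deg: "\<mu> ! k = \<eta> ! i"
    if k: "Suc k < n" and i: "Suc i < n" and nz: "\<phi> (matrix_unit n i (Suc i)) $$ (k, Suc k) \<noteq> 0" for i k
  proof -
    have g: "\<eta> ! i \<in> carrier G" using \<eta> i nth_mem[of i \<eta>] by (auto simp: group_tuples_def)
    have "matrix_unit n i (Suc i) \<in> (grading_of_tuple G n \<eta> (\<eta> ! i) :: 'k mat set)"
      unfolding grading_of_tuple_eq
      using unit_degree_step[OF \<eta> i]
      by (intro position_gradingI[OF g matrix_unit_UJ]) (auto split: if_splits)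
    then have "\<phi> (matrix_unit n i (Suc i)) \<in> position_grading G n (unit_degree G \<mu>) (\<eta> ! i)"
      using graded g unfolding grading_of_tuple_eq by blast
    from position_gradingD(2)[OF this g _ k nz] show ?thesis
      using unit_degree_step[OF \<mu> k] by simp
  qed
  from UJ_automorphism_superdiag[OF two hom bij mult] show ?thesis
  proof
    assume *: "\<forall>k. Suc k < n \<longrightarrow> \<phi> (matrix_unit n k (Suc k)) $$ (k, Suc k) \<noteq> 0"
    have "\<mu> = \<eta>" by (rule nth_equalityI) (use deg * len in auto)
    then show ?thesis ..
  next
    assume *: "\<forall>k. Suc k < n \<longrightarrow> \<phi> (matrix_unit n (n - Suc (Suc k)) (n - Suc k)) $$ (k, Suc k) \<noteq> 0"
    have "\<mu> = rev \<eta>"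
    proof (rule nth_equalityI)
      fix k assume "k < length \<mu>"
      then have k: "Suc k < n" using len by simp
      then have "Suc (n - Suc (Suc k)) = n - Suc k" by simp
      then have "\<mu> ! k = \<eta> ! (n - Suc (Suc k))" using deg[OF k, of "n - Suc (Suc k)"] * k by simp
      \<comment> \<open>The tuples have length \<open>n - 1\<close>, so position \<open>k\<close> of
        \<open>rev \<eta>\<close> is position \<open>n - Suc (Suc k)\<close> of
        \<open>\<eta>\<close>.\<close>
      then show "\<mu> ! k = rev \<eta> ! k" using k len by (simp add: rev_nth)
    qed (use len in simp)
    then show ?thesis ..
  qed
qed

section \<open>Bijections between quotients induced by maps of representatives\<close>

lemma quotient_bijection:
  assumes R: "equiv A R" and S: "equiv B S"
    and F: "\<And>a. a \<in> A \<Longrightarrow> F a \<in> B"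
    and rel: "\<And>a b. a \<in> A \<Longrightarrow> b \<in> A \<Longrightarrow> (a, b) \<in> R \<longleftrightarrow> (F a, F b) \<in> S"
    and surj: "\<And>b. b \<in> B \<Longrightarrow> \<exists>a\<in>A. (F a, b) \<in> S"
  shows "\<exists>\<Phi>. bij_betw \<Phi> (A // R) (B // S) \<and> (\<forall>a\<in>A. \<Phi> (R `` {a}) = S `` {F a})"
proof -
  \<comment> \<open>The union over all representatives avoids a choice; all of them contribute the
    same class.\<close>
  define \<Phi> where "\<Phi> X = (\<Union>a\<in>X. S `` {F a})" for X
  have \<Phi>: "\<Phi> (R `` {a}) = S `` {F a}" if a: "a \<in> A" for a
  proof -
    have "S `` {F b} = S `` {F a}" if "b \<in> R `` {a}" for b
    proof -
      have "b \<in> A" using that R by (auto simp: equiv_def refl_on_def)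
      then have "(F a, F b) \<in> S" using rel[OF a] that by simp
      then show ?thesis using equiv_class_eq[OF S] by metis
    qed
    moreover have "a \<in> R `` {a}" by (rule equiv_class_self[OF R a])
    ultimately show ?thesis unfolding \<Phi>_def by blast
  qed
  \<comment> \<open>The forward direction of \<open>rel\<close> made \<open>\<Phi>\<close> well
    defined; the backward direction makes it injective.\<close>
  have "inj_on \<Phi> (A // R)"
  proof (rule inj_onI)
    fix X Y assume "X \<in> A // R" "Y \<in> A // R" and eq: "\<Phi> X = \<Phi> Y"
    then obtain a b where ab: "a \<in> A" "X = R `` {a}" "b \<in> A" "Y = R `` {b}"
      by (auto elim!: quotientE)
    then have "(F a, F b) \<in> S"
      using eq \<Phi> eq_equiv_class_iff[OF S F F, of a b] by simp
    then show "X = Y" using ab rel equiv_class_eq[OF R] by blast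
  qed
  moreover have "\<Phi> ` (A // R) = B // S"
  proof
    show "\<Phi> ` (A // R) \<subseteq> B // S"
      using \<Phi> F by (auto elim!: quotientE intro!: quotientI)
    show "B // S \<subseteq> \<Phi> ` (A // R)"
    proof
      fix Y assume "Y \<in> B // S"
      then obtain b where b: "b \<in> B" "Y = S `` {b}" by (rule quotientE)
      then obtain a where a: "a \<in> A" "(F a, b) \<in> S" using surj by blast
      then have "Y = \<Phi> (R `` {a})" using b \<Phi>[OF a(1)] equiv_class_eq[OF S a(2)] by simp
      then show "Y \<in> \<Phi> ` (A // R)" using quotientI[OF a(1), of R] by blast
    qed
  qed
  ultimately show ?thesis using \<Phi> by (auto simp: bij_betw_def)
qed

theorem theorem11:
  fixes G :: "('g, 'm) monoid_scheme" and n :: nat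
  assumes char: "CHAR('k::field) \<noteq> 2" and n: "n \<ge> 2"
  shows
    "(group G \<longrightarrow>
        (\<forall>D \<in> (elementary_gradings G n :: ('g \<Rightarrow> 'k mat set) set).
           \<forall>g \<in> grading_support G (UJ n) D. \<forall>h \<in> grading_support G (UJ n) D.
             g \<otimes>\<^bsub>G\<^esub> h = h \<otimes>\<^bsub>G\<^esub> g)) \<and>
     (comm_group G \<longrightarrow>
        (\<exists>\<Phi>. bij_betw \<Phi>
               (group_tuples G (n - 1) // reversal_rel G (n - 1))
               ((elementary_gradings G n :: ('g \<Rightarrow> 'k mat set) set) // elementary_iso_rel G n) \<and>
             (\<forall>\<eta> \<in> group_tuples G (n - 1).
                \<Phi> (reversal_rel G (n - 1) `` {\<eta>}) = elementary_iso_rel G n `` {grading_of_tuple G n \<eta>})))"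
proof (intro conjI impI)
  \<comment> \<open>If 2 were zero, the characteristic would divide 2, and it is never 1.\<close>
  have two: "(2::'k) \<noteq> 0"
  proof
    assume "(2::'k) = 0"
    then have "of_nat 2 = (0::'k)" by simp
    then have "CHAR('k) dvd 2" by (simp only: of_nat_eq_0_iff_char_dvd)
    then have "CHAR('k) = 1 \<or> CHAR('k) = 2" using prime_nat_iff two_is_prime_nat by blast
    then show False using char CHAR_not_1 by simp
  qed
  show "\<forall>D \<in> (elementary_gradings G n :: ('g \<Rightarrow> 'k mat set) set).
      \<forall>g \<in> grading_support G (UJ n) D. \<forall>h \<in> grading_support G (UJ n) D. g \<otimes>\<^bsub>G\<^esub> h = h \<otimes>\<^bsub>G\<^esub> g"
    if "group G"
  proof (intro ballI)
    interpret group G by fact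
    fix D :: "'g \<Rightarrow> 'k mat set" and g h
    assume D: "D \<in> elementary_gradings G n"
      and gh: "g \<in> grading_support G (UJ n) D" "h \<in> grading_support G (UJ n) D"
    obtain d where D_eq: "D = position_grading G n d"
      and d: "\<And>i j. i \<le> j \<Longrightarrow> j < n \<Longrightarrow> d i j \<in> carrier G"
      "\<And>i j k. i \<le> j \<Longrightarrow> j \<le> k \<Longrightarrow> k < n \<Longrightarrow> d i k = d i j \<otimes>\<^bsub>G\<^esub> d j k"
      "\<And>i j k. i \<le> j \<Longrightarrow> j \<le> k \<Longrightarrow> k < n \<Longrightarrow> d i k = d j k \<otimes>\<^bsub>G\<^esub> d i j"
      using elementary_grading_is_position_grading[OF two D m_closed] by blast
    obtain i j where g: "i \<le> j" "j < n" "g = d i j"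
      by (rule support_position_grading[OF gh(1)[unfolded D_eq]])
    obtain k l where h: "k \<le> l" "l < n" "h = d k l"
      by (rule support_position_grading[OF gh(2)[unfolded D_eq]])
    show "g \<otimes>\<^bsub>G\<^esub> h = h \<otimes>\<^bsub>G\<^esub> g"
      unfolding g(3) h(3) by (rule path_degrees_commute[OF d g(1,2) h(1,2)])
  qed
  show "\<exists>\<Phi>. bij_betw \<Phi> (group_tuples G (n - 1) // reversal_rel G (n - 1))
      ((elementary_gradings G n :: ('g \<Rightarrow> 'k mat set) set) // elementary_iso_rel G n) \<and>
      (\<forall>\<eta> \<in> group_tuples G (n - 1).
        \<Phi> (reversal_rel G (n - 1) `` {\<eta>}) = elementary_iso_rel G n `` {grading_of_tuple G n \<eta>})"
    if "comm_group G"
  proof (rule quotient_bijection[OF equiv_reversal_rel equiv_elementary_iso_rel])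
    interpret comm_group G by fact
    let ?D = "grading_of_tuple G n :: 'g list \<Rightarrow> 'g \<Rightarrow> 'k mat set"
    show elem: "?D \<eta> \<in> elementary_gradings G n" if "\<eta> \<in> group_tuples G (n - 1)" for \<eta>
      by (rule grading_of_tuple_elementary[OF that])
    have refl: "(D, D) \<in> elementary_iso_rel G n" if "D \<in> elementary_gradings G n" for D :: "'g \<Rightarrow> 'k mat set"
      using equiv_elementary_iso_rel that by (auto simp: equiv_def refl_on_def)
    \<comment> \<open>Every elementary grading is equal to some \<open>?D \<eta>\<close>, so
      reflexivity suffices.\<close>
    show "\<exists>\<eta>\<in>group_tuples G (n - 1). (?D \<eta>, D) \<in> elementary_iso_rel G n"
      if D: "D \<in> elementary_gradings G n" for D
      using elementary_grading_is_grading_of_tuple[OF two D] refl[OF D] by metis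
    show "(\<mu>, \<nu>) \<in> reversal_rel G (n - 1) \<longleftrightarrow> (?D \<mu>, ?D \<nu>) \<in> elementary_iso_rel G n"
      if \<mu>: "\<mu> \<in> group_tuples G (n - 1)" and \<nu>: "\<nu> \<in> group_tuples G (n - 1)" for \<mu> \<nu>
    proof
      assume "(\<mu>, \<nu>) \<in> reversal_rel G (n - 1)"
      \<comment> \<open>Equality up to reversal is symmetric, as \<open>rev\<close> is an
        involution.\<close>
      then have "\<nu> = \<mu> \<or> \<nu> = rev \<mu>" by (auto simp: reversal_rel_def)
      then show "(?D \<mu>, ?D \<nu>) \<in> elementary_iso_rel G n"
        using refl[OF elem[OF \<mu>]] graded_isomorphic_rev[OF \<mu>] elem[OF \<mu>] elem[OF \<nu>]
        by (auto simp: elementary_iso_rel_def)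
    next
      assume "(?D \<mu>, ?D \<nu>) \<in> elementary_iso_rel G n"
      then have "\<nu> = \<mu> \<or> \<nu> = rev \<mu>"
        using graded_isomorphic_tuples[OF two \<mu> \<nu>] by (simp add: elementary_iso_rel_def)
      then show "(\<mu>, \<nu>) \<in> reversal_rel G (n - 1)"
        using \<mu> \<nu> by (auto simp: reversal_rel_def)
    qed
  qed
qed

end
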